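(* Let $\alpha>0$ and let $k$ be a kernel (symmetric, integrable, nonnegative, $k(0)=0$) with $k(1)>0$ and finite $\alpha$-th moment, i.e. $\sum_{j\in\mathbb{Z}}k(j)|j|^\alpha<\infty$. Let $L$ be the operator generated by $k$. Suppose that $L$ satisfies $CD_\Upsilon(0,F)$ with a $CD$-function $F$ such that $F(x)\sim c_1x^\gamma$ as $x\to0$ and $F(x)\sim c_2e^{\delta x}$ as $x\to\infty$, where $\gamma\ge2$ and $\delta,c_1,c_2>0$. Let $p_t(x,y)$, $x,y\in\mathbb{Z}$, be the heat kernel of the equation $\partial_tu-Lu=0$ on $(0,\infty)\times\mathbb{Z}$. Then there exist a constant $c=c(F)>0$, constants $\tau_1,\tau_2\in\mathbb{R}$ depending only on $c,\gamma,\delta$, and a constant $C_0=C_0(c,\gamma,\delta)>0$ such that for any $\nu>0$ $$\exp\Big(-\Big(\Lambda(t)+\frac{2|x-y|^2}{k(1)\,t}\Big)\Big)\ \le\ p_t(x,y)\ \le\ \frac{\exp\big(C_0\nu+\frac{2}{k(1)}\big)}{2\big\lfloor\sqrt{c(t,\nu)-t}\,\big\rfloor},\qquad x,y\in\mathbb{Z},\ t>0,$$ where, with $t_*=\frac{\delta^{\gamma-1}}{2^\gamma c\,e^2}$, $\Lambda:(0,\infty)\to(0,\infty)$ is given by $$\Lambda(t)=\begin{cases}\frac t\delta\big(1-\log(2^\gamma c\,\delta^{1-\gamma}t)\big), & t\le t_*,\\[2pt] \frac{\log t}{c\,e^2}+\tau_1, & t>t_*\text{ and }\gamma=2,\\[2pt]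 \frac{((\gamma-1)t)^{\frac{\gamma-2}{\gamma-1}}}{(c\,e^2)^{\frac1{\gamma-1}}(\gamma-2)}+\tau_2, & t>t_*\text{ and }\gamma>2,\end{cases}$$ and where $c(t,\nu)=\big(\frac{\gamma-2}{\gamma-1}\nu+t^{\frac{\gamma-2}{\gamma-1}}\big)^{\frac{\gamma-1}{\gamma-2}}$ if $\gamma>2$ and $c(t,\nu)=e^\nu t$ if $\gamma=2$. (The upper bound is understood as $+\infty$ when $\lfloor\sqrt{c(t,\nu)-t}\rfloor=0$.)
   Context: Kernel and operator: $k:\mathbb{Z}\to[0,\infty)$, $k(0)=0$, $k(j)=k(-j)$ for all $j$, and $\sum_{j\in\mathbb{Z}}k(j)<\infty$. The operator generated by $k$ is $Lu(x)=\sum_{j\in\mathbb{Z}}k(j)\big(u(x+j)-u(x)\big)$, $x\in\mathbb{Z}$. $\ell^\infty(\mathbb{Z})$ denotes the bounded functions $\mathbb{Z}\to\mathbb{R}$. $f\sim g$ as $x\to x_0$ means $f(x)/g(x)\to1$ as $x\to x_0$. $\lfloor\cdot\rfloor$ is the floor function. Heat kernel: $p_t(x,y)$ is the (bounded) solution of $p_0(x,y)=1$ if $x=y$ and $0$ otherwise, and $\partial_tp_t(x,y)=\sum_{z\in\mathbb{Z}}k(x-z)\big(p_t(z,y)-p_t(x,y)\big)$ for $x,y\in\mathbb{Z}$. Let $\Upsilon(r)=e^r-1-r$, $r\in\mathbb{R}$. For $u,v\in\ell^\infty(\mathbb{Z})$ put $\Psi_\Upsilon(u)(x)=\sum_{y\in\mathbb{Z}}k(x-y)\Upsilon(u(y)-u(x))$,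 $B_{\Upsilon'}(u,v)(x)=\sum_{y\in\mathbb{Z}}k(x-y)\Upsilon'(u(y)-u(x))(v(y)-v(x))$ and $\Psi_{2,\Upsilon}(u)(x)=\frac12\big(L\Psi_\Upsilon(u)(x)-B_{\Upsilon'}(u,Lu)(x)\big)$. A $CD$-function is a continuous $F:[0,\infty)\to[0,\infty)$ with $F(0)=0$, $r\mapsto F(r)/r$ strictly increasing on $(0,\infty)$, and $1/F$ integrable at $\infty$. $L$ satisfies $CD_\Upsilon(0,F)$ if for every $u\in\ell^\infty(\mathbb{Z})$ and every $x\in\mathbb{Z}$: $\Psi_{2,\Upsilon}(u)(x)\ge F(-Lu(x))$ whenever $-Lu(x)\ge 0$ (and $\Psi_{2,\Upsilon}(u)(x)\ge 0$ otherwise). *)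

theory Defs
  imports "HOL-Analysis.Analysis" "HOL-Library.Landau_Symbols"
begin

definition jump_kernel :: "(int \<Rightarrow> real) \<Rightarrow> bool" where
  "jump_kernel k \<longleftrightarrow>
     (\<forall>j. 0 \<le> k j) \<and> k 0 = 0 \<and> (\<forall>j. k j = k (- j)) \<and> k summable_on UNIV"

definition gen :: "(int \<Rightarrow> real) \<Rightarrow> (int \<Rightarrow> real) \<Rightarrow> int \<Rightarrow> real" where
  "gen k u x = (\<Sum>\<^sub>\<infinity>j. k j * (u (x + j) - u x))"

definition Upsilon :: "real \<Rightarrow> real" where
  "Upsilon r = exp r - 1 - r"

lemma deriv_Upsilon: "deriv Upsilon r = exp r - 1"
proof (rule DERIV_imp_deriv)
  show "(Upsilon has_field_derivative exp r - 1) (at r)"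
    unfolding Upsilon_def[abs_def] by (auto intro!: derivative_eq_intros)
qed

definition Psi :: "(int \<Rightarrow> real) \<Rightarrow> (real \<Rightarrow> real) \<Rightarrow> (int \<Rightarrow> real) \<Rightarrow> int \<Rightarrow> real" where
  "Psi k H u x = (\<Sum>\<^sub>\<infinity>y. k (x - y) * H (u y - u x))"

definition B_op ::
  "(int \<Rightarrow> real) \<Rightarrow> (real \<Rightarrow> real) \<Rightarrow> (int \<Rightarrow> real) \<Rightarrow> (int \<Rightarrow> real) \<Rightarrow> int \<Rightarrow> real" where
  "B_op k H u v x = (\<Sum>\<^sub>\<infinity>y. k (x - y) * H (u y - u x) * (v y - v x))"

definition Psi2_Upsilon :: "(int \<Rightarrow> real) \<Rightarrow> (int \<Rightarrow> real) \<Rightarrow> int \<Rightarrow> real" where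
  "Psi2_Upsilon k u x =
     (gen k (Psi k Upsilon u) x - B_op k (deriv Upsilon) u (gen k u) x) / 2"

text \<open>A function on the half-line \<open>[0,\<infinity>)\<close> is represented by a total function of which only
  the values on \<open>{0..}\<close> are constrained.\<close>

definition CD_function :: "(real \<Rightarrow> real) \<Rightarrow> bool" where
  "CD_function F \<longleftrightarrow>
     continuous_on {0..} F \<and> (\<forall>r\<ge>0. 0 \<le> F r) \<and> F 0 = 0 \<and>
     strict_mono_on {0<..} (\<lambda>r. F r / r) \<and>
     (\<exists>a>0. set_integrable lborel {a..} (\<lambda>r. 1 / F r))"

definition CD_Upsilon :: "(int \<Rightarrow> real) \<Rightarrow> (real \<Rightarrow> real) \<Rightarrow> bool" where
  "CD_Upsilon k F \<longleftrightarrow>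
     (\<forall>u x. bounded (range u) \<longrightarrow>
        (if 0 \<le> - gen k u x then F (- gen k u x) \<le> Psi2_Upsilon k u x
         else 0 \<le> Psi2_Upsilon k u x))"

text \<open>For every \<open>y\<close>, the function \<open>(t, x) \<mapsto> p t x y\<close> is the bounded solution of the heat equation
  with initial datum the indicator of \<open>y\<close>: it is continuous in \<open>t\<close> up to the initial time \<open>0\<close> and
  satisfies the equation for \<open>t > 0\<close>. The values of \<open>p\<close> at negative times are irrelevant.\<close>

definition heat_kernel :: "(int \<Rightarrow> real) \<Rightarrow> (real \<Rightarrow> int \<Rightarrow> int \<Rightarrow> real) \<Rightarrow> bool" where
  "heat_kernel k p \<longleftrightarrow>
     (\<forall>y. \<exists>M. \<forall>t\<ge>0. \<forall>x. \<bar>p t x y\<bar> \<le> M) \<and>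
     (\<forall>x y. p 0 x y = (if x = y then 1 else 0)) \<and>
     (\<forall>x y. continuous_on {0..} (\<lambda>t. p t x y)) \<and>
     (\<forall>x y. \<forall>t>0. ((\<lambda>s. p s x y) has_real_derivative
        (\<Sum>\<^sub>\<infinity>z. k (x - z) * (p t z y - p t x y))) (at t))"

definition t_star :: "real \<Rightarrow> real \<Rightarrow> real \<Rightarrow> real" where
  "t_star c \<gamma> \<delta> = \<delta> powr (\<gamma> - 1) / (2 powr \<gamma> * c * exp 2)"

text \<open>The last two branches are the cases \<open>\<gamma> = 2\<close> and \<open>\<gamma> > 2\<close>; only \<open>\<gamma> \<ge> 2\<close> matters, here and in
  the definition of \<open>c_time\<close>, which is \<open>c(t,\<nu>)\<close>.\<close>

definition Lam :: "real \<Rightarrow> real \<Rightarrow> real \<Rightarrow> real \<Rightarrow> real \<Rightarrow> real \<Rightarrow> real" where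
  "Lam c \<gamma> \<delta> \<tau>1 \<tau>2 t =
     (if t \<le> t_star c \<gamma> \<delta> then t / \<delta> * (1 - ln (2 powr \<gamma> * c * \<delta> powr (1 - \<gamma>) * t))
      else if \<gamma> = 2 then ln t / (c * exp 2) + \<tau>1
      else ((\<gamma> - 1) * t) powr ((\<gamma> - 2) / (\<gamma> - 1))
             / ((c * exp 2) powr (1 / (\<gamma> - 1)) * (\<gamma> - 2)) + \<tau>2)"

definition c_time :: "real \<Rightarrow> real \<Rightarrow> real \<Rightarrow> real" where
  "c_time \<gamma> t \<nu> =
     (if \<gamma> = 2 then exp \<nu> * t
      else ((\<gamma> - 2) / (\<gamma> - 1) * \<nu> + t powr ((\<gamma> - 2) / (\<gamma> - 1))) powr ((\<gamma> - 1) / (\<gamma> - 2)))"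

end

theory Submission
  imports Defs "HOL-Real_Asymp.Real_Asymp"
begin

text \<open>The proof combines a Li--Yau estimate with a Harnack inequality. For a positive solution \<open>u\<close> with
bounded logarithm \<open>v = ln u\<close> one has \<open>\<partial>\<^sub>t v = L v + \<Psi>\<^sub>\<Upsilon>(v)\<close>. Differentiating once more, the curvature
condition gives \<open>\<partial>\<^sub>t G \<le> N G - 2 F(G)\<close> for \<open>G = - L v\<close> where \<open>G \<ge> 0\<close>, with a jump operator \<open>N\<close> of bounded
rates. By a maximum principle (\<open>maximum_principle\<close>), \<open>G\<close> lies below every supersolution \<open>\<phi>\<close> of
\<open>\<phi>' = - 2 F(\<phi>)\<close> that is infinite at time \<open>0\<close>; this is \<open>li_yau\<close>.

Consequently \<open>\<partial>\<^sub>t v \<ge> \<Psi>\<^sub>\<Upsilon>(v) - \<phi>\<close>. Keeping in \<open>\<Psi>\<^sub>\<Upsilon>\<close> only the jumps to the two neighbours and using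
\<open>\<Upsilon>(r) \<ge> r\<^sup>2 / 2\<close> for \<open>r \<ge> 0\<close>, one can move along nearest-neighbour paths and obtains
\<open>p a x y \<le> p b z y * exp (\<integral>\<phi> + 2 (x - z)\<^sup>2 / (k 1 (b - a)))\<close>, the integral being over \<open>{a..b}\<close>
(\<open>heat_kernel_harnack\<close>). Symmetry and the sub-Markov property of the heat kernel follow from the
maximum principle too.

Instead of solving the differential equation for \<open>\<phi>\<close>, an explicit smooth supersolution is used, namely
\<open>\<phi>(t) = ln (1 + 1 / (A t) + (A t) powr - (1 / (\<gamma> - 1))) / \<delta>\<close>. Inside the logarithm, \<open>1 / (A t)\<close> matches the
exponential growth of \<open>F\<close> and the power matches its behaviour at \<open>0\<close>. The speed \<open>A\<close> is a multiple of
\<open>c\<close>, so that \<open>\<phi>\<close> is a supersolution once \<open>c\<close> is small in terms of \<open>F\<close>; the multiple is chosen so large that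
\<open>\<phi>\<close> is at most the derivative of \<open>\<Lambda>\<close> on either side of \<open>t\<^sub>*\<close>. Hence its integral from any sufficiently
small positive time up to \<open>t\<close> is at most \<open>\<Lambda>(t)\<close>.

Harnack's inequality from time \<open>0\<close> on the diagonal then yields the lower bound. For the upper bound
the later time is \<open>c(t,\<nu>)\<close>, chosen such that the integral of \<open>\<phi>\<close> over \<open>[t, c(t,\<nu>)]\<close> is at most
\<open>C\<^sub>0 \<nu>\<close>, and the inequality is summed over all sites at distance at most \<open>\<surd>(c(t,\<nu>) - t)\<close>.\<close>

section \<open>Scalar monotonicity, a maximum principle, differentiation of sums\<close>

lemma nondecreasing_if_derivative_nonneg:
  fixes f f' :: "real \<Rightarrow> real"
  assumes "a \<le> b" "continuous_on {a..b} f"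
    and der: "\<And>t. a < t \<Longrightarrow> t < b \<Longrightarrow> (f has_real_derivative f' t) (at t)"
    and "\<And>t. a < t \<Longrightarrow> t < b \<Longrightarrow> 0 \<le> f' t"
  shows "f a \<le> f b"
  using assms
  by (intro DERIV_nonneg_imp_increasing_open[of a b f]) blast+

text \<open>A barrier argument in one variable: after the last time at which \<open>f \<le> m\<close> the function cannot
increase, so it never gets above \<open>m\<close>.\<close>
lemma le_if_derivative_nonpos_above:
  fixes f f' :: "real \<Rightarrow> real"
  assumes ab: "a \<le> b" and cont: "continuous_on {a..b} f"
    and der: "\<And>t. a < t \<Longrightarrow> t < b \<Longrightarrow> (f has_real_derivative f' t) (at t)"
    and "f a \<le> m" and above: "\<And>t. a < t \<Longrightarrow> t < b \<Longrightarrow> m < f t \<Longrightarrow> f' t \<le> 0"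
  shows "f b \<le> m"
proof (rule ccontr)
  assume "\<not> f b \<le> m"
  define Z where "Z = {t \<in> {a..b}. f t \<le> m}"
  have "closed Z"
    using continuous_closed_preimage[OF cont closed_atLeastAtMost closed_atMost, of m]
    by (simp add: Z_def vimage_def Int_def)
  moreover have "Z \<subseteq> {a..b}" "a \<in> Z"
    using ab \<open>f a \<le> m\<close> by (auto simp: Z_def)
  ultimately have sZ: "Sup Z \<in> Z" and bZ: "bdd_above Z"
    by (auto intro!: closed_contains_Sup intro: bdd_above_mono)
  define s where "s = Sup Z"
  have s: "a \<le> s" "s \<le> b" "f s \<le> m"
    using sZ by (auto simp: s_def Z_def)
  have "s < b"
    using s \<open>\<not> f b \<le> m\<close> by (cases "s = b") auto
  have gt: "m < f t" if "s < t" "t \<le> b" for t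
  proof (rule ccontr)
    assume "\<not> m < f t"
    then have "t \<in> Z" using that s by (auto simp: Z_def)
    then show False using cSup_upper[OF _ bZ] that(1) by (force simp: s_def)
  qed
  have "continuous_on {s..b} f"
    using cont by (rule continuous_on_subset) (use s in auto)
  moreover have "f differentiable (at t)" if "s < t" "t < b" for t
    using der[of t] that s by (auto simp: real_differentiable_def)
  ultimately obtain l z where z: "s < z" "z < b" "(f has_real_derivative l) (at z)"
    "f b - f s = (b - s) * l"
    using MVT[OF \<open>s < b\<close>, of f] by blast
  have "l = f' z" using DERIV_unique[OF z(3) der[of z]] z s by auto
  then have "l \<le> 0" using above[of z] gt[of z] z s by auto
  then have "(b - s) * l \<le> 0" using \<open>s < b\<close> by (simp add: mult_nonneg_nonpos)
  then show False using z(4) s(3) \<open>\<not> f b \<le> m\<close> by linarith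
qed

text \<open>The state space is infinite, so the supremum of \<open>H t\<close> need not be attained and the classical argument
at a maximum point is not available. Bounded jump rates replace it: where \<open>H\<close> is positive,
its derivative is at most \<open>R\<close> times any upper bound of \<open>H t\<close>. For \<open>h = exp (- 2 R (t - t0)) H\<close> with an upper bound
\<open>S \<ge> 0\<close>, this makes \<open>h\<close> nonincreasing in time wherever it exceeds \<open>S / 2\<close>, so \<open>S / 2\<close> is an upper
bound as well. Halving repeatedly leaves \<open>h \<le> 0\<close>.\<close>
lemma maximum_principle:
  fixes H H' :: "real \<Rightarrow> 'a \<Rightarrow> real"
  assumes cont: "\<And>x. continuous_on {t0..} (\<lambda>t. H t x)"
    and der: "\<And>x t. t0 < t \<Longrightarrow> ((\<lambda>s. H s x) has_real_derivative H' t x) (at t)"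
    and bdd: "\<And>x t. t0 \<le> t \<Longrightarrow> H t x \<le> M"
    and init: "\<And>x. H t0 x \<le> 0"
    and growth: "\<And>x t S. t0 < t \<Longrightarrow> 0 < H t x \<Longrightarrow> (\<And>y. H t y \<le> S) \<Longrightarrow> H' t x \<le> R * S"
    and "0 \<le> R" "t0 \<le> t"
  shows "H t x \<le> 0"
proof -
  define h where "h = (\<lambda>t x. exp (- (2 * R * (t - t0))) * H t x)"
  have halve: "\<forall>x. \<forall>t\<ge>t0. h t x \<le> S / 2"
    if S: "\<forall>x. \<forall>t\<ge>t0. h t x \<le> S" "0 \<le> S" for S
  proof (intro allI impI)
    fix x t assume "t0 \<le> t"
    show "h t x \<le> S / 2"
    proof (rule le_if_derivative_nonpos_above[where f = "\<lambda>t. h t x" and a = t0 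
          and f' = "\<lambda>t. exp (- (2 * R * (t - t0))) * (H' t x - 2 * R * H t x)"])
      show "continuous_on {t0..t} (\<lambda>t. h t x)"
        unfolding h_def by (intro continuous_intros continuous_on_subset[OF cont]) auto
      show "h t0 x \<le> S / 2" using init[of x] \<open>0 \<le> S\<close> by (simp add: h_def)
    next
      fix s assume "t0 < s" "s < t"
      then show "((\<lambda>t. h t x) has_real_derivative
          exp (- (2 * R * (s - t0))) * (H' s x - 2 * R * H s x)) (at s)"
        unfolding h_def by (auto intro!: derivative_eq_intros der simp: algebra_simps)
    next
      fix s assume s: "t0 < s" "s < t" "S / 2 < h s x"
      define e where "e = exp (2 * R * (s - t0))"
      have e: "h s y = H s y / e" for y
        by (simp add: h_def e_def exp_minus divide_simps)
      have "0 < e" by (simp add: e_def)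
      have "0 < h s x" using s(3) \<open>0 \<le> S\<close> by linarith
      then have "0 < H s x" using \<open>0 < e\<close> by (simp add: e zero_less_divide_iff)
      moreover have "H s y \<le> e * S" for y
        using S(1)[rule_format, of s y] s \<open>0 < e\<close> by (simp add: e divide_simps mult.commute)
      ultimately have "H' s x \<le> R * (e * S)" using growth s by blast
      also have "\<dots> \<le> R * (2 * H s x)"
        using s(3) \<open>0 < e\<close> \<open>0 \<le> R\<close> by (intro mult_left_mono) (auto simp: e divide_simps mult.commute)
      finally show "exp (- (2 * R * (s - t0))) * (H' s x - 2 * R * H s x) \<le> 0"
        by (simp add: mult_nonneg_nonpos)
    qed (use \<open>t0 \<le> t\<close> in auto)
  qed
  have "\<forall>x. \<forall>t\<ge>t0. h t x \<le> max M 0 / 2 ^ n" for n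
  proof (induction n)
    case 0
    have "exp (- (2 * R * (t - t0))) * H t x \<le> 1 * max M 0" if "t0 \<le> t" for t x
    proof (rule order_trans)
      show "exp (- (2 * R * (t - t0))) * H t x \<le> exp (- (2 * R * (t - t0))) * max M 0"
        using bdd[of t x] that by (intro mult_left_mono) auto
      show "exp (- (2 * R * (t - t0))) * max M 0 \<le> 1 * max M 0"
        using that \<open>0 \<le> R\<close> by (intro mult_right_mono) auto
    qed
    then show ?case by (simp add: h_def)
  next
    case (Suc n)
    show ?case using halve[OF Suc] by (simp add: field_simps)
  qed
  then have "h t x \<le> max M 0 / 2 ^ n" for n using \<open>t0 \<le> t\<close> by blast
  moreover have "(\<lambda>n. max M 0 / 2 ^ n) \<longlonglongrightarrow> (0::real)"
    by (rule LIMSEQ_divide_realpow_zero) simp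
  ultimately have "h t x \<le> 0" by (intro LIMSEQ_le_const) auto
  then show ?thesis by (simp add: h_def mult_le_0_iff)
qed

text \<open>Termwise differentiation over an arbitrary index set. The difference quotients inherit the summable
bound \<open>m\<close> from the mean value theorem, and the limit is interchanged with the sum by the Weierstrass
M-test.\<close>
lemma has_derivative_infsum:
  fixes f f' :: "real \<Rightarrow> 'a \<Rightarrow> real"
  assumes "open U" "convex U" "t \<in> U" and m: "m summable_on UNIV"
    and der: "\<And>s j. s \<in> U \<Longrightarrow> ((\<lambda>s. f s j) has_real_derivative f' s j) (at s)"
    and bound: "\<And>s j. s \<in> U \<Longrightarrow> \<bar>f' s j\<bar> \<le> m j"
    and sum: "\<And>s. s \<in> U \<Longrightarrow> f s summable_on UNIV"
  shows "((\<lambda>s. \<Sum>\<^sub>\<infinity>j. f s j) has_real_derivative (\<Sum>\<^sub>\<infinity>j. f' t j)) (at t)"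
proof -
  define q where "q = (\<lambda>j s. (f s j - f t j) / (s - t))"
  have qb: "norm (q j s) \<le> m j" if s: "s \<in> U - {t}" for j s
  proof -
    have "norm (f s j - f t j) \<le> m j * norm (s - t)"
      by (rule field_differentiable_bound[OF \<open>convex U\<close>, of "\<lambda>s. f s j" "\<lambda>s. f' s j"])
        (use der bound s \<open>t \<in> U\<close> in \<open>auto intro: DERIV_subset\<close>)
    then show ?thesis using s by (simp add: q_def divide_simps)
  qed
  have "((\<lambda>s. \<Sum>\<^sub>\<infinity>j. q j s) \<longlongrightarrow> (\<Sum>\<^sub>\<infinity>j. f' t j)) (at t)"
  proof (rule swap_uniform_limit')
    show "uniform_limit (U - {t}) (\<lambda>J s. \<Sum>j\<in>J. q j s) (\<lambda>s. \<Sum>\<^sub>\<infinity>j. q j s)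
        (finite_subsets_at_top UNIV)"
      by (rule Weierstrass_m_test_general[OF qb m])
    have "(q j \<longlongrightarrow> f' t j) (at t)" for j
      using der[OF \<open>t \<in> U\<close>] by (simp add: has_field_derivative_iff q_def)
    then show "\<forall>\<^sub>F J in finite_subsets_at_top UNIV.
        ((\<lambda>s. \<Sum>j\<in>J. q j s) \<longlongrightarrow> (\<Sum>j\<in>J. f' t j)) (at t)"
      by (intro always_eventually allI tendsto_sum)
    have "(\<lambda>j. norm (f' t j)) summable_on UNIV"
      by (rule Infinite_Sum.abs_summable_on_comparison_test'[OF m]) (use bound \<open>t \<in> U\<close> in auto)
    then have "f' t summable_on UNIV" by (rule abs_summable_summable)
    then show "((\<lambda>J. \<Sum>j\<in>J. f' t j) \<longlongrightarrow> (\<Sum>\<^sub>\<infinity>j. f' t j)) (finite_subsets_at_top UNIV)"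
      using has_sum_infsum by (force simp: has_sum_def)
    show "\<forall>\<^sub>F s in at t. s \<in> U - {t}"
      using \<open>open U\<close> \<open>t \<in> U\<close> by (auto simp: eventually_at_topological)
  qed auto
  moreover have "\<forall>\<^sub>F s in at t. (\<Sum>\<^sub>\<infinity>j. q j s) = ((\<Sum>\<^sub>\<infinity>j. f s j) - (\<Sum>\<^sub>\<infinity>j. f t j)) / (s - t)"
  proof (rule eventually_mono)
    show "\<forall>\<^sub>F s in at t. s \<in> U"
      using \<open>open U\<close> \<open>t \<in> U\<close> by (auto simp: eventually_at_topological)
    fix s assume "s \<in> U"
    then have "((\<lambda>j. f s j + - f t j) has_sum ((\<Sum>\<^sub>\<infinity>j. f s j) + - (\<Sum>\<^sub>\<infinity>j. f t j))) UNIV"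
      by (intro has_sum_add has_sum_uminusI has_sum_infsum sum \<open>t \<in> U\<close>)
    then have "((\<lambda>j. (f s j + - f t j) * inverse (s - t)) has_sum
        ((\<Sum>\<^sub>\<infinity>j. f s j) + - (\<Sum>\<^sub>\<infinity>j. f t j)) * inverse (s - t)) UNIV"
      by (rule has_sum_cmult_left)
    then show "(\<Sum>\<^sub>\<infinity>j. q j s) = ((\<Sum>\<^sub>\<infinity>j. f s j) - (\<Sum>\<^sub>\<infinity>j. f t j)) / (s - t)"
      by (intro infsumI) (simp add: q_def divide_inverse)
  qed
  ultimately show ?thesis
    unfolding has_field_derivative_iff by (rule Lim_transform_eventually)
qed

section \<open>The generator and the logarithm of a solution\<close>
lemma summable_kernel_mult:
  fixes h :: "int \<Rightarrow> real"
  assumes "jump_kernel k" "\<And>j. \<bar>h j\<bar> \<le> C"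
  shows "(\<lambda>j. k j * h j) summable_on UNIV"
proof -
  have "(\<lambda>j. C * k j) summable_on UNIV"
    using assms(1) by (intro summable_on_cmult_right) (simp add: jump_kernel_def)
  then have "(\<lambda>j. norm (k j * h j)) summable_on UNIV"
    by (rule Infinite_Sum.abs_summable_on_comparison_test')
      (use assms in \<open>auto simp: jump_kernel_def abs_mult mult.commute[of C] intro!: mult_left_mono\<close>)
  then show ?thesis by (rule abs_summable_summable)
qed

lemma infsum_kernel_mult_le:
  fixes h :: "int \<Rightarrow> real"
  assumes "jump_kernel k" "\<And>j. \<bar>h j\<bar> \<le> C" "\<And>j. h j \<le> B"
  shows "(\<Sum>\<^sub>\<infinity>j. k j * h j) \<le> infsum k UNIV * B"
proof -
  have "(\<Sum>\<^sub>\<infinity>j. k j * h j) \<le> (\<Sum>\<^sub>\<infinity>j. k j * B)"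
    using assms(1) by (intro infsum_mono summable_kernel_mult[OF assms(1,2)] summable_on_cmult_left
        mult_left_mono assms(3)) (auto simp: jump_kernel_def)
  then show ?thesis by (simp add: infsum_cmult_left')
qed

lemma abs_infsum_kernel_mult_le:
  fixes h :: "int \<Rightarrow> real"
  assumes "jump_kernel k" "\<And>j. \<bar>h j\<bar> \<le> C"
  shows "\<bar>\<Sum>\<^sub>\<infinity>j. k j * h j\<bar> \<le> infsum k UNIV * C"
proof -
  have "(\<Sum>\<^sub>\<infinity>j. k j * h j) \<le> infsum k UNIV * C"
    using assms(2) by (intro infsum_kernel_mult_le[OF assms]) (simp add: abs_le_D1)
  moreover have "(\<Sum>\<^sub>\<infinity>j. k j * - h j) \<le> infsum k UNIV * C"
    using assms(2) by (intro infsum_kernel_mult_le[OF assms(1)]) (auto simp: abs_le_D2)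
  ultimately show ?thesis by (simp add: infsum_uminus abs_le_iff)
qed

lemma kernel_mass_nonneg: "jump_kernel k \<Longrightarrow> 0 \<le> infsum k UNIV"
  by (auto simp: jump_kernel_def intro: infsum_nonneg)

lemma infsum_kernel_add:
  fixes f g :: "int \<Rightarrow> real"
  assumes "jump_kernel k" "\<And>j. \<bar>f j\<bar> \<le> C" "\<And>j. \<bar>g j\<bar> \<le> D"
  shows "(\<Sum>\<^sub>\<infinity>j. k j * (f j + g j)) = (\<Sum>\<^sub>\<infinity>j. k j * f j) + (\<Sum>\<^sub>\<infinity>j. k j * g j)"
  using infsum_add[OF summable_kernel_mult[OF assms(1,2)] summable_kernel_mult[OF assms(1,3)]]
  by (simp add: distrib_left)

text \<open>The operators \<^const>\<open>Psi\<close> and \<^const>\<open>B_op\<close> sum over target sites, \<^const>\<open>gen\<close> over jumps; symmetry of the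
kernel identifies the two conventions.\<close>
lemma infsum_kernel_shift:
  fixes h :: "int \<Rightarrow> real"
  assumes "jump_kernel k"
  shows "(\<Sum>\<^sub>\<infinity>y. k (x - y) * h y) = (\<Sum>\<^sub>\<infinity>j. k j * h (x + j))"
proof (rule infsum_reindex_bij_witness[where i = "\<lambda>j. x + j" and j = "\<lambda>y. y - x"])
  fix y
  have "k (x - y) = k (- (x - y))" using assms unfolding jump_kernel_def by blast
  then show "k (y - x) * h (x + (y - x)) = k (x - y) * h y" by simp
qed auto

lemma gen_bound:
  assumes "jump_kernel k" "\<And>x. \<bar>u x\<bar> \<le> M"
  shows "\<bar>gen k u x\<bar> \<le> infsum k UNIV * (2 * M)"
  unfolding gen_def
proof (rule abs_infsum_kernel_mult_le[OF assms(1)])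
  fix j show "\<bar>u (x + j) - u x\<bar> \<le> 2 * M"
    using assms(2)[of x] assms(2)[of "x + j"] by linarith
qed

lemma Psi_eq: "jump_kernel k \<Longrightarrow> Psi k H u x = (\<Sum>\<^sub>\<infinity>j. k j * H (u (x + j) - u x))"
  unfolding Psi_def by (rule infsum_kernel_shift)

lemma B_op_eq:
  "jump_kernel k \<Longrightarrow>
    B_op k H u v x = (\<Sum>\<^sub>\<infinity>j. k j * (H (u (x + j) - u x) * (v (x + j) - v x)))"
  using infsum_kernel_shift[of k x "\<lambda>y. H (u y - u x) * (v y - v x)"]
  unfolding B_op_def by (simp add: mult.assoc)

lemma Upsilon_ge_square: "0 \<le> r \<Longrightarrow> r\<^sup>2 / 2 \<le> Upsilon r"
  using exp_lower_Taylor_quadratic[of r] by (simp add: Upsilon_def)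

lemma Upsilon_nonneg: "0 \<le> Upsilon r"
  using exp_ge_add_one_self[of r] unfolding Upsilon_def by linarith

lemma Upsilon_mono: "0 \<le> r \<Longrightarrow> r \<le> s \<Longrightarrow> Upsilon r \<le> Upsilon s"
proof (rule DERIV_nonneg_imp_nondecreasing[of r s])
  fix x assume "0 \<le> r" "r \<le> x"
  then show "\<exists>y. (Upsilon has_real_derivative y) (at x) \<and> 0 \<le> y"
    unfolding Upsilon_def[abs_def]
    by (intro exI[of _ "exp x - 1"]) (auto intro!: derivative_eq_intros)
qed

lemma Upsilon_bound: "\<bar>r\<bar> \<le> M \<Longrightarrow> \<bar>Upsilon r\<bar> \<le> exp M + M"
proof -
  assume "\<bar>r\<bar> \<le> M"
  then have "exp r \<le> exp M" "- r \<le> M" by auto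
  then show ?thesis using Upsilon_nonneg[of r] unfolding Upsilon_def by linarith
qed

lemma Psi_Upsilon_bound:
  assumes "jump_kernel k" "\<And>x. \<bar>u x\<bar> \<le> M"
  shows "\<bar>Psi k Upsilon u x\<bar> \<le> infsum k UNIV * (exp (2 * M) + 2 * M)"
  unfolding Psi_eq[OF assms(1)]
proof (intro abs_infsum_kernel_mult_le[OF assms(1)] Upsilon_bound)
  fix j show "\<bar>u (x + j) - u x\<bar> \<le> 2 * M"
    using assms(2)[of x] assms(2)[of "x + j"] by linarith
qed

text \<open>The discrete chain rule for the logarithm: it turns \<open>\<partial>\<^sub>t u = L u\<close> into
\<open>\<partial>\<^sub>t v = L v + \<Psi>\<^sub>\<Upsilon>(v)\<close> for \<open>v = ln u\<close>, because \<open>exp d - 1 = d + \<Upsilon>(d)\<close>.\<close>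
lemma gen_div_eq_log:
  assumes k: "jump_kernel k" and v: "\<And>x. \<bar>v x\<bar> \<le> M"
  shows "gen k (\<lambda>y. exp (v y)) x / exp (v x) = gen k v x + Psi k Upsilon v x"
proof -
  have d: "\<bar>v (x + j) - v x\<bar> \<le> 2 * M" for j using v[of x] v[of "x + j"] by linarith
  have "gen k (\<lambda>y. exp (v y)) x / exp (v x)
      = (\<Sum>\<^sub>\<infinity>j. k j * (exp (v (x + j)) - exp (v x)) * inverse (exp (v x)))"
    unfolding gen_def infsum_cmult_left' divide_inverse ..
  also have "\<dots> = (\<Sum>\<^sub>\<infinity>j. k j * ((v (x + j) - v x) + Upsilon (v (x + j) - v x)))"
    by (intro infsum_cong) (simp add: Upsilon_def exp_diff field_simps)
  also have "\<dots> = gen k v x + Psi k Upsilon v x"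
    unfolding gen_def Psi_eq[OF k] using d
    by (intro infsum_kernel_add[OF k, where C = "2 * M" and D = "exp (2 * M) + 2 * M"] Upsilon_bound)
  finally show ?thesis .
qed

text \<open>The identity that explains the definition of \<^const>\<open>Psi2_Upsilon\<close>. Applying \<open>L\<close> to the equation for
\<open>v = ln u\<close> gives \<open>L L v + L \<Psi>\<^sub>\<Upsilon>(v)\<close>. Up to twice the curvature term this equals a jump operator
applied to \<open>L v\<close> whose rates \<open>k(j) exp (v(x + j) - v(x))\<close> are nonnegative, and so it obeys a maximum
principle.\<close>
lemma gen_log_rhs_eq:
  assumes k: "jump_kernel k" and v: "\<And>x. \<bar>v x\<bar> \<le> M"
  shows "gen k (\<lambda>y. gen k v y + Psi k Upsilon v y) x
    = 2 * Psi2_Upsilon k v x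
      + (\<Sum>\<^sub>\<infinity>j. k j * (exp (v (x + j) - v x) * (gen k v (x + j) - gen k v x)))"
proof -
  define K where "K = infsum k UNIV"
  have d: "\<bar>v (x + j) - v x\<bar> \<le> 2 * M" for j using v[of x] v[of "x + j"] by linarith
  have g: "\<bar>gen k v (x + j) - gen k v x\<bar> \<le> 2 * (K * (2 * M))" for j
    using gen_bound[where u = v, OF k v] unfolding K_def
    by (smt (verit))
  have p: "\<bar>Psi k Upsilon v (x + j) - Psi k Upsilon v x\<bar> \<le> 2 * (K * (exp (2 * M) + 2 * M))" for j
    using Psi_Upsilon_bound[where u = v, OF k v] unfolding K_def
    by (smt (verit))
  have "\<bar>exp (v (x + j) - v x) - 1\<bar> \<le> exp (2 * M) + 1" for j
  proof -
    have "exp (v (x + j) - v x) \<le> exp (2 * M)" using d[of j] by simp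
    moreover have "0 < exp (v (x + j) - v x)" by simp
    ultimately show ?thesis by linarith
  qed
  then have b: "\<bar>(exp (v (x + j) - v x) - 1) * (gen k v (x + j) - gen k v x)\<bar>
      \<le> (exp (2 * M) + 1) * (2 * (K * (2 * M)))" for j
    unfolding abs_mult by (intro mult_mono g) auto
  have "gen k (\<lambda>y. gen k v y + Psi k Upsilon v y) x
      = (\<Sum>\<^sub>\<infinity>j. k j * ((gen k v (x + j) - gen k v x)
          + (Psi k Upsilon v (x + j) - Psi k Upsilon v x)))"
    unfolding gen_def[of k "\<lambda>y. gen k v y + Psi k Upsilon v y"]
    by (simp add: algebra_simps)
  also have "\<dots> = gen k (gen k v) x + gen k (Psi k Upsilon v) x"
    unfolding gen_def[of k "gen k v"] gen_def[of k "Psi k Upsilon v"]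
    by (rule infsum_kernel_add[OF k g p])
  also have "gen k (Psi k Upsilon v) x
      = 2 * Psi2_Upsilon k v x + B_op k (deriv Upsilon) v (gen k v) x"
    by (simp add: Psi2_Upsilon_def field_simps)
  also have "gen k (gen k v) x + (2 * Psi2_Upsilon k v x + B_op k (deriv Upsilon) v (gen k v) x)
      = 2 * Psi2_Upsilon k v x + (gen k (gen k v) x + B_op k (deriv Upsilon) v (gen k v) x)"
    by simp
  also have "gen k (gen k v) x + B_op k (deriv Upsilon) v (gen k v) x
      = (\<Sum>\<^sub>\<infinity>j. k j * ((gen k v (x + j) - gen k v x)
          + (exp (v (x + j) - v x) - 1) * (gen k v (x + j) - gen k v x)))"
    unfolding gen_def[of k "gen k v"] B_op_eq[OF k] deriv_Upsilon
    by (rule infsum_kernel_add[OF k g b, symmetric])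
  also have "\<dots> = (\<Sum>\<^sub>\<infinity>j. k j * (exp (v (x + j) - v x) * (gen k v (x + j) - gen k v x)))"
    by (simp add: algebra_simps)
  finally show ?thesis .
qed

lemma has_derivative_gen:
  assumes k: "jump_kernel k" and "0 < t"
    and der: "\<And>s x. 0 < s \<Longrightarrow> ((\<lambda>s. v s x) has_real_derivative w s x) (at s)"
    and v: "\<And>s x. 0 < s \<Longrightarrow> \<bar>v s x\<bar> \<le> M" and w: "\<And>s x. 0 < s \<Longrightarrow> \<bar>w s x\<bar> \<le> N"
  shows "((\<lambda>s. gen k (v s) x) has_real_derivative gen k (w t) x) (at t)"
  unfolding gen_def
proof (rule has_derivative_infsum[where U = "{0<..}" and m = "\<lambda>j. k j * (2 * N)"
      and f' = "\<lambda>t j. k j * (w t (x + j) - w t x)"])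
  show "(\<lambda>j. k j * (2 * N)) summable_on UNIV"
    by (rule summable_kernel_mult[OF k order_refl])
  fix s :: real and j assume s: "s \<in> {0<..}"
  show "((\<lambda>s. k j * (v s (x + j) - v s x)) has_real_derivative k j * (w s (x + j) - w s x)) (at s)"
    using s by (auto intro!: derivative_eq_intros der)
  have "\<bar>w s (x + j) - w s x\<bar> \<le> 2 * N" using w[of s x] w[of s "x + j"] s by simp
  then show "\<bar>k j * (w s (x + j) - w s x)\<bar> \<le> k j * (2 * N)"
    using k by (auto simp: jump_kernel_def abs_mult intro!: mult_left_mono)
next
  fix s :: real assume s: "s \<in> {0<..}"
  have "\<bar>v s (x + j) - v s x\<bar> \<le> 2 * M" for j using v[of s x] v[of s "x + j"] s by simp
  then show "(\<lambda>j. k j * (v s (x + j) - v s x)) summable_on UNIV"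
    by (rule summable_kernel_mult[OF k])
qed (use \<open>0 < t\<close> in auto)

text \<open>The Li--Yau estimate. The quantity \<open>G = - L v\<close> satisfies \<open>\<partial>\<^sub>t G \<le> N G - 2 F(G)\<close> where \<open>G \<ge> 0\<close>, with \<open>N\<close>
the jump operator of the previous lemma, while \<open>\<phi>\<close> is a supersolution of \<open>\<phi>' = - 2 F(\<phi>)\<close> that starts
from infinity. Where \<open>G > \<phi>\<close> monotonicity of \<open>F\<close> removes the nonlinear terms, and the maximum principle
applies to \<open>G - \<phi>\<close>.\<close>
lemma li_yau:
  assumes k: "jump_kernel k" and CD: "CD_Upsilon k F"
    and Fmono: "\<And>r s. 0 < r \<Longrightarrow> r \<le> s \<Longrightarrow> F r \<le> F s"
    and v: "\<And>s x. 0 < s \<Longrightarrow> \<bar>v s x\<bar> \<le> M"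
    and der: "\<And>s x. 0 < s \<Longrightarrow>
      ((\<lambda>s. v s x) has_real_derivative gen k (v s) x + Psi k Upsilon (v s) x) (at s)"
    and \<phi>der: "\<And>s. 0 < s \<Longrightarrow> (\<phi> has_real_derivative \<phi>' s) (at s)"
    and \<phi>pos: "\<And>s. 0 < s \<Longrightarrow> 0 < \<phi> s"
    and super: "\<And>s. 0 < s \<Longrightarrow> - \<phi>' s \<le> 2 * F (\<phi> s)"
    and blowup: "filterlim \<phi> at_top (at_right 0)"
    and "0 < t"
  shows "- gen k (v t) x \<le> \<phi> t"
proof -
  define K where "K = infsum k UNIV"
  have "0 \<le> K" using k by (simp add: K_def kernel_mass_nonneg)
  define w where "w = (\<lambda>s x. gen k (v s) x + Psi k Upsilon (v s) x)"
  have G: "\<bar>gen k (v s) x\<bar> \<le> K * (2 * M)" if "0 < s" for s x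
    unfolding K_def by (rule gen_bound[OF k v[OF that]])
  have w: "\<bar>w s x\<bar> \<le> K * (2 * M) + K * (exp (2 * M) + 2 * M)" if "0 < s" for s x
    using G[OF that, of x] Psi_Upsilon_bound[where u = "v s" and x = x, OF k v[OF that]]
    unfolding w_def K_def by linarith
  have dG: "((\<lambda>s. gen k (v s) x) has_real_derivative gen k (w s) x) (at s)" if "0 < s" for s x
    by (rule has_derivative_gen[OF k that _ v w]) (use der in \<open>auto simp: w_def\<close>)
  define H where "H = (\<lambda>s x. - gen k (v s) x - \<phi> s)"
  define H' where "H' = (\<lambda>s x. - gen k (w s) x - \<phi>' s)"
  have dH: "((\<lambda>s. H s x) has_real_derivative H' s x) (at s)" if "0 < s" for s x
    using that unfolding H_def H'_def by (auto intro!: derivative_eq_intros dG \<phi>der)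
  have "\<forall>\<^sub>F s in at_right 0. K * (2 * M) \<le> \<phi> s"
    using blowup by (simp add: filterlim_at_top)
  then obtain b where b: "0 < b" "\<And>s. 0 < s \<Longrightarrow> s < b \<Longrightarrow> K * (2 * M) \<le> \<phi> s"
    unfolding eventually_at_right_field by auto
  \<comment> \<open>\<open>G\<close> is bounded and \<open>\<phi>\<close> blows up at \<open>0\<close>, so the comparison holds at every small enough time.\<close>
  define t0 where "t0 = min t (b / 2)"
  have t0: "0 < t0" "t0 \<le> t" "t0 < b" using b \<open>0 < t\<close> by (auto simp: t0_def)
  have "H t x \<le> 0"
  proof (rule maximum_principle[where H = H and H' = H' and R = "K * exp (2 * M)" and M = "K * (2 * M)" and ?t0.0 = t0])
    show "continuous_on {t0..} (\<lambda>t. H t x)" for x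
      using t0 by (auto intro!: continuous_at_imp_continuous_on DERIV_isCont[OF dH])
    show "H s x \<le> K * (2 * M)" if "t0 \<le> s" for s x
      using G[of s x] \<phi>pos[of s] that t0 by (simp add: H_def)
    show "H t0 x \<le> 0" for x
      using G[of t0 x] b(2)[of t0] t0 by (simp add: H_def)
    show "0 \<le> K * exp (2 * M)" using \<open>0 \<le> K\<close> by simp
  next
    fix x s S assume s: "t0 < s" "0 < H s x" and S: "\<And>y. H s y \<le> S"
    have "0 < s" using s t0 by linarith
    note vs = v[OF \<open>0 < s\<close>]
    have "0 \<le> S" using S[of x] s by linarith
    have gx: "0 < \<phi> s" "\<phi> s < - gen k (v s) x"
      using s \<phi>pos[OF \<open>0 < s\<close>] by (auto simp: H_def)
    have bd: "bounded (range (v s))"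
      by (rule boundedI[of _ M]) (use vs in auto)
    have "F (\<phi> s) \<le> F (- gen k (v s) x)" using gx by (intro Fmono) auto
    also have "\<dots> \<le> Psi2_Upsilon k (v s) x"
      using CD bd gx unfolding CD_Upsilon_def by (auto dest!: spec[of _ "v s"] spec[of _ x])
    finally have F: "F (\<phi> s) \<le> Psi2_Upsilon k (v s) x" .
    define e where "e = (\<lambda>j. exp (v s (x + j) - v s x))"
    have e: "0 < e j" "e j \<le> exp (2 * M)" for j
      using vs[of x] vs[of "x + j"] by (auto simp: e_def)
    have "(\<Sum>\<^sub>\<infinity>j. k j * (e j * (gen k (v s) x - gen k (v s) (x + j)))) \<le> K * (exp (2 * M) * S)"
      unfolding K_def
    proof (rule infsum_kernel_mult_le[OF k])
      fix j
      have "\<bar>gen k (v s) x - gen k (v s) (x + j)\<bar> \<le> 2 * (K * (2 * M))"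
        using G[OF \<open>0 < s\<close>, of x] G[OF \<open>0 < s\<close>, of "x + j"] by linarith
      then show "\<bar>e j * (gen k (v s) x - gen k (v s) (x + j))\<bar> \<le> exp (2 * M) * (2 * (K * (2 * M)))"
        unfolding abs_mult using e[of j] by (intro mult_mono) auto
      have "gen k (v s) x - gen k (v s) (x + j) \<le> S"
        using S[of "x + j"] s by (simp add: H_def)
      then have "e j * (gen k (v s) x - gen k (v s) (x + j)) \<le> e j * S"
        using e[of j] by (intro mult_left_mono) auto
      also have "\<dots> \<le> exp (2 * M) * S" using e[of j] \<open>0 \<le> S\<close> by (intro mult_right_mono) auto
      finally show "e j * (gen k (v s) x - gen k (v s) (x + j)) \<le> exp (2 * M) * S" .
    qed
    moreover have "(\<Sum>\<^sub>\<infinity>j. k j * (e j * (gen k (v s) x - gen k (v s) (x + j))))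
        = - (\<Sum>\<^sub>\<infinity>j. k j * (e j * (gen k (v s) (x + j) - gen k (v s) x)))"
      by (simp add: infsum_uminus[symmetric] algebra_simps)
    ultimately have "- gen k (w s) x \<le> K * (exp (2 * M) * S) - 2 * Psi2_Upsilon k (v s) x"
      using gen_log_rhs_eq[where v = "v s" and x = x, OF k vs] unfolding w_def e_def by simp
    then show "H' s x \<le> K * exp (2 * M) * S"
      using F super[OF \<open>0 < s\<close>] by (simp add: H'_def)
  next
    show "((\<lambda>s. H s x) has_real_derivative H' s x) (at s)" if "t0 < s" for x s
      using dH that t0 by simp
  qed (use t0 in auto)
  then show ?thesis by (simp add: H_def)
qed

section \<open>From the Li--Yau estimate to a Harnack inequality\<close>

text \<open>One step between neighbouring sites: \<open>V\<close> and \<open>W\<close> stand for \<open>v + \<Phi>\<close> at the two sites, with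
\<open>\<Phi>' = \<phi>\<close>. As \<open>V\<close> does not decrease, the deficit \<open>d = V a - W\<close> satisfies
\<open>d' \<le> - \<kappa> \<Upsilon>(d) \<le> - \<kappa> d\<^sup>2 / 2\<close> as long as it is positive. Hence \<open>1 / d\<close> grows at least at rate
\<open>\<kappa> / 2\<close>, and \<open>d b \<le> 2 / (\<kappa> (b - a))\<close>.\<close>
lemma harnack_step:
  fixes V W V' W' :: "real \<Rightarrow> real"
  assumes "a < b" "0 < \<kappa>"
    and contV: "continuous_on {a..b} V" and contW: "continuous_on {a..b} W"
    and derV: "\<And>s. a < s \<Longrightarrow> s < b \<Longrightarrow> (V has_real_derivative V' s) (at s)"
    and derW: "\<And>s. a < s \<Longrightarrow> s < b \<Longrightarrow> (W has_real_derivative W' s) (at s)"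
    and V': "\<And>s. a < s \<Longrightarrow> s < b \<Longrightarrow> 0 \<le> V' s"
    and W': "\<And>s. a < s \<Longrightarrow> s < b \<Longrightarrow> \<kappa> * Upsilon (V s - W s) \<le> W' s"
  shows "V a \<le> W b + 2 / (\<kappa> * (b - a))"
proof (rule ccontr)
  assume neg: "\<not> ?thesis"
  define d where "d = (\<lambda>s. V a - W s)"
  have W'0: "0 \<le> W' s" if "a < s" "s < b" for s
    using W'[OF that] Upsilon_nonneg[of "V s - W s"] \<open>0 < \<kappa>\<close>
    by (meson mult_nonneg_nonneg less_imp_le order_trans)
  have V: "V a \<le> V s" if "a \<le> s" "s \<le> b" for s
    by (rule nondecreasing_if_derivative_nonneg[OF that(1) _ derV V'])
      (use that in \<open>auto intro: continuous_on_subset[OF contV]\<close>)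
  have W: "W s \<le> W b" if "a \<le> s" "s \<le> b" for s
    by (rule nondecreasing_if_derivative_nonneg[OF that(2) _ derW W'0])
      (use that in \<open>auto intro: continuous_on_subset[OF contW]\<close>)
  have gap: "0 < 2 / (\<kappa> * (b - a))" using assms by simp
  have d: "0 < d s" if "a \<le> s" "s \<le> b" for s
    using W[OF that] neg gap unfolding d_def by linarith
  have "1 / d a - \<kappa> / 2 * a \<le> 1 / d b - \<kappa> / 2 * b"
  proof (rule nondecreasing_if_derivative_nonneg[of a b "\<lambda>s. 1 / d s - \<kappa> / 2 * s"
        "\<lambda>s. W' s / (d s)\<^sup>2 - \<kappa> / 2"])
    fix s assume s: "a < s" "s < b"
    have "(d s)\<^sup>2 / 2 \<le> Upsilon (d s)" using d[of s] s by (intro Upsilon_ge_square) auto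
    also have "\<dots> \<le> Upsilon (V s - W s)"
      using d[of s] V[of s] s by (intro Upsilon_mono) (auto simp: d_def)
    finally have "\<kappa> * ((d s)\<^sup>2 / 2) \<le> W' s"
      using W'[OF s] \<open>0 < \<kappa>\<close> by (meson mult_left_mono less_imp_le order_trans)
    then show "0 \<le> W' s / (d s)\<^sup>2 - \<kappa> / 2"
      using d[of s] s by (simp add: field_simps)
  next
    fix s assume s: "a < s" "s < b"
    then show "((\<lambda>s. 1 / d s - \<kappa> / 2 * s) has_real_derivative W' s / (d s)\<^sup>2 - \<kappa> / 2) (at s)"
      unfolding d_def using d[of s] s
      by (auto intro!: derivative_eq_intros derW simp: d_def power2_eq_square)
  next
    show "continuous_on {a..b} (\<lambda>s. 1 / d s - \<kappa> / 2 * s)"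
      using d by (force simp: d_def intro!: continuous_intros contW)
  qed (use \<open>a < b\<close> in auto)
  moreover have "0 < 1 / d a" using d[of a] \<open>a < b\<close> by simp
  ultimately have "\<kappa> / 2 * b - \<kappa> / 2 * a < 1 / d b" by linarith
  then have "\<kappa> / 2 * (b - a) < 1 / d b" by (simp add: right_diff_distrib)
  then have "d b < 2 / (\<kappa> * (b - a))"
    using d[of b] assms(1,2) by (simp add: field_simps)
  then show False using neg by (simp add: d_def)
qed

text \<open>With \<open>n = \<bar>x - y\<bar>\<close> unit steps, each taking the time \<open>(b - a) / n\<close>, the \<open>n\<close> losses
\<open>2 n / (\<kappa> (b - a))\<close> add up to \<open>2 n\<^sup>2 / (\<kappa> (b - a))\<close>.\<close>
lemma harnack_chain:
  fixes v v' :: "real \<Rightarrow> int \<Rightarrow> real" and \<Phi> \<phi> :: "real \<Rightarrow> real"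
  assumes "a < b" "0 < \<kappa>"
    and cont: "\<And>x. continuous_on {a..b} (\<lambda>s. v s x)" and cont\<Phi>: "continuous_on {a..b} \<Phi>"
    and der: "\<And>s x. a < s \<Longrightarrow> s < b \<Longrightarrow> ((\<lambda>s. v s x) has_real_derivative v' s x) (at s)"
    and der\<Phi>: "\<And>s. a < s \<Longrightarrow> s < b \<Longrightarrow> (\<Phi> has_real_derivative \<phi> s) (at s)"
    and v': "\<And>s x. a < s \<Longrightarrow> s < b \<Longrightarrow>
      \<kappa> * (Upsilon (v s (x + 1) - v s x) + Upsilon (v s (x - 1) - v s x)) - \<phi> s \<le> v' s x"
  shows "v a x \<le> v b y + (\<Phi> b - \<Phi> a) + 2 * (real_of_int \<bar>x - y\<bar>)\<^sup>2 / (\<kappa> * (b - a))"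
proof -
  define V where "V = (\<lambda>s x. v s x + \<Phi> s)"
  have contV: "continuous_on {a..b} (\<lambda>s. V s x)" for x
    unfolding V_def by (intro continuous_intros cont cont\<Phi>)
  have derV: "((\<lambda>s. V s x) has_real_derivative v' s x + \<phi> s) (at s)" if "a < s" "s < b" for s x
    unfolding V_def using that by (auto intro!: derivative_eq_intros der der\<Phi>)
  have step: "\<kappa> * Upsilon (V s z - V s x) \<le> v' s x + \<phi> s"
    if s: "a < s" "s < b" and z: "z = x + 1 \<or> z = x - 1" for s x z
  proof -
    have "\<kappa> * Upsilon (v s z - v s x)
        \<le> \<kappa> * (Upsilon (v s (x + 1) - v s x) + Upsilon (v s (x - 1) - v s x))"
      using z \<open>0 < \<kappa>\<close> Upsilon_nonneg by auto
    then show ?thesis using v'[OF s, of x] by (simp add: V_def)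
  qed
  have nonneg: "0 \<le> v' s x + \<phi> s" if s: "a < s" "s < b" for s x
    using step[OF s, of "x + 1" x] \<open>0 < \<kappa>\<close> Upsilon_nonneg[of "V s (x + 1) - V s x"]
    by (meson mult_nonneg_nonneg less_imp_le order_trans)
  have "V a x \<le> V b y + 2 * (real_of_int \<bar>x - y\<bar>)\<^sup>2 / (\<kappa> * (b - a))"
  proof (cases "x = y")
    case True
    have "V a x \<le> V b x"
      by (rule nondecreasing_if_derivative_nonneg[OF _ contV derV nonneg])
        (use \<open>a < b\<close> in auto)
    then show ?thesis using True by simp
  next
    case False
    define n where "n = nat \<bar>x - y\<bar>"
    define h where "h = (b - a) / real n"
    define z where "z = (\<lambda>i. x + int i * sgn (y - x))"
    have n: "0 < n" "real n = real_of_int \<bar>x - y\<bar>" using False by (auto simp: n_def)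
    have h: "0 < h" "real n * h = b - a" using n \<open>a < b\<close> by (auto simp: h_def)
    have "V a x \<le> V (a + real i * h) (z i) + real i * (2 / (\<kappa> * h))" if "i \<le> n" for i
      using that
    proof (induction i)
      case 0
      show ?case by (simp add: z_def)
    next
      case (Suc i)
      define s where "s = a + real i * h"
      have "real (Suc i) * h \<le> real n * h" using Suc.prems h by (intro mult_right_mono) auto
      then have s: "a \<le> s" "s + h \<le> b" using h by (auto simp: s_def algebra_simps)
      have z: "z i = z (Suc i) + 1 \<or> z i = z (Suc i) - 1"
        using False by (auto simp: z_def sgn_if algebra_simps)
      have "V s (z i) \<le> V (s + h) (z (Suc i)) + 2 / (\<kappa> * (s + h - s))"
        by (rule harnack_step[where V' = "\<lambda>s. v' s (z i) + \<phi> s"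
              and W' = "\<lambda>s. v' s (z (Suc i)) + \<phi> s"])
          (use h s \<open>0 < \<kappa>\<close> z in \<open>auto intro!: derV nonneg step continuous_on_subset[OF contV]\<close>)
      then show ?case using Suc by (simp add: s_def algebra_simps add_divide_distrib)
    qed
    from this[of n] have "V a x \<le> V b (z n) + real n * (2 / (\<kappa> * h))" using h by simp
    moreover have "z n = y" by (simp add: z_def n_def sgn_if)
    moreover have "real n * (2 / (\<kappa> * h)) = 2 * (real n)\<^sup>2 / (\<kappa> * (b - a))"
      using n \<open>0 < \<kappa>\<close> \<open>a < b\<close> by (simp add: h_def power2_eq_square field_simps)
    ultimately show ?thesis using n by simp
  qed
  then show ?thesis by (simp add: V_def)
qed

section \<open>Bounded solutions and the heat kernel\<close>

text \<open>The initial value is left open, which makes the solutions a vector space that is invariant under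
reflections; the heat kernel is compared with combinations of its own reflections and of constants.\<close>
definition bounded_solution :: "(int \<Rightarrow> real) \<Rightarrow> (real \<Rightarrow> int \<Rightarrow> real) \<Rightarrow> bool" where
  "bounded_solution k u \<longleftrightarrow>
     (\<exists>M. \<forall>t\<ge>0. \<forall>x. \<bar>u t x\<bar> \<le> M) \<and>
     (\<forall>x. continuous_on {0..} (\<lambda>t. u t x)) \<and>
     (\<forall>x. \<forall>t>0. ((\<lambda>s. u s x) has_real_derivative gen k (u t) x) (at t))"

lemma bounded_solutionE:
  assumes "bounded_solution k u"
  obtains M where "\<And>t x. 0 \<le> t \<Longrightarrow> \<bar>u t x\<bar> \<le> M" "\<And>x. continuous_on {0..} (\<lambda>t. u t x)"
    "\<And>x t. 0 < t \<Longrightarrow> ((\<lambda>s. u s x) has_real_derivative gen k (u t) x) (at t)"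
  using assms unfolding bounded_solution_def by metis

lemma bounded_solution_const: "bounded_solution k (\<lambda>t x. c)"
  unfolding bounded_solution_def by (auto simp: gen_def)

lemma bounded_solution_add_mult:
  assumes k: "jump_kernel k" and "bounded_solution k u" "bounded_solution k w"
  shows "bounded_solution k (\<lambda>t x. u t x + c * w t x)"
proof -
  obtain M where u: "\<And>t x. 0 \<le> t \<Longrightarrow> \<bar>u t x\<bar> \<le> M" "\<And>x. continuous_on {0..} (\<lambda>t. u t x)"
    "\<And>x t. 0 < t \<Longrightarrow> ((\<lambda>s. u s x) has_real_derivative gen k (u t) x) (at t)"
    using assms(2) by (rule bounded_solutionE) blast
  obtain N where w: "\<And>t x. 0 \<le> t \<Longrightarrow> \<bar>w t x\<bar> \<le> N" "\<And>x. continuous_on {0..} (\<lambda>t. w t x)"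
    "\<And>x t. 0 < t \<Longrightarrow> ((\<lambda>s. w s x) has_real_derivative gen k (w t) x) (at t)"
    using assms(3) by (rule bounded_solutionE) blast
  have "\<bar>u t x + c * w t x\<bar> \<le> M + \<bar>c\<bar> * N" if "0 \<le> t" for t x
    using u(1)[OF that, of x] mult_left_mono[OF w(1)[OF that, of x], of "\<bar>c\<bar>"]
    by (intro order_trans[OF abs_triangle_ineq]) (simp add: abs_mult)
  moreover have "gen k (\<lambda>x. u t x + c * w t x) x = gen k (u t) x + c * gen k (w t) x"
    if "0 < t" for t x
  proof -
    have "\<bar>u t (x + j) - u t x\<bar> \<le> 2 * M" for j
      using u(1)[of t x] u(1)[of t "x + j"] that by simp
    moreover have "\<bar>c * (w t (x + j) - w t x)\<bar> \<le> \<bar>c\<bar> * (2 * N)" for j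
      using w(1)[of t x] w(1)[of t "x + j"] that unfolding abs_mult by (intro mult_left_mono) auto
    ultimately have "(\<Sum>\<^sub>\<infinity>j. k j * ((u t (x + j) - u t x) + c * (w t (x + j) - w t x)))
        = gen k (u t) x + (\<Sum>\<^sub>\<infinity>j. k j * (c * (w t (x + j) - w t x)))"
      unfolding gen_def by (rule infsum_kernel_add[OF k])
    also have "(\<Sum>\<^sub>\<infinity>j. k j * (c * (w t (x + j) - w t x))) = c * gen k (w t) x"
      unfolding gen_def infsum_cmult_right'[symmetric] by (simp add: mult.left_commute)
    finally show ?thesis by (simp add: gen_def algebra_simps)
  qed
  ultimately show ?thesis
    unfolding bounded_solution_def using u w
    by (auto intro!: exI[of _ "M + \<bar>c\<bar> * N"] continuous_intros derivative_eq_intros simp: mult.commute)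
qed

lemma bounded_solution_sum:
  assumes "jump_kernel k" "finite A" "\<And>z. z \<in> A \<Longrightarrow> bounded_solution k (u z)"
  shows "bounded_solution k (\<lambda>t x. \<Sum>z\<in>A. u z t x)"
  using assms(2,3)
proof (induction A rule: finite_induct)
  case empty
  show ?case using bounded_solution_const[of k 0] by simp
next
  case (insert z A)
  then have "bounded_solution k (\<lambda>t x. u z t x + 1 * (\<Sum>z\<in>A. u z t x))"
    by (intro bounded_solution_add_mult[OF assms(1)]) auto
  then show ?case using insert by simp
qed

lemma bounded_solution_reflect:
  assumes k: "jump_kernel k" and u: "bounded_solution k u"
  shows "bounded_solution k (\<lambda>t x. u t (c - x))"
proof -
  have "gen k (\<lambda>x. u t (c - x)) x = gen k (u t) (c - x)" for t x
    unfolding gen_def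
  proof (rule infsum_reindex_bij_witness[where i = uminus and j = uminus])
    fix j
    have "k (- j) = k j" using k unfolding jump_kernel_def by metis
    then show "k (- j) * (u t (c - x + - j) - u t (c - x))
        = k j * (u t (c - (x + j)) - u t (c - x))"
      by (simp add: algebra_simps)
  qed auto
  then show ?thesis using u unfolding bounded_solution_def by simp metis
qed

text \<open>The maximum principle applies to the difference because the total jump rate is finite. In particular
a bounded solution is determined by its initial value.\<close>
lemma bounded_solution_mono:
  assumes k: "jump_kernel k" and u: "bounded_solution k u" and w: "bounded_solution k w"
    and init: "\<And>x. u 0 x \<le> w 0 x" and "0 \<le> t"
  shows "u t x \<le> w t x"
proof -
  define H where "H = (\<lambda>t x. u t x + - 1 * w t x)"
  have "bounded_solution k H"
    unfolding H_def by (rule bounded_solution_add_mult[OF k u w])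
  then obtain M where H: "\<And>t x. 0 \<le> t \<Longrightarrow> \<bar>H t x\<bar> \<le> M" "\<And>x. continuous_on {0..} (\<lambda>t. H t x)"
    "\<And>x t. 0 < t \<Longrightarrow> ((\<lambda>s. H s x) has_real_derivative gen k (H t) x) (at t)"
    by (rule bounded_solutionE) blast
  have "H t x \<le> 0"
  proof (rule maximum_principle[where H = H and ?t0.0 = 0 and M = M and R = "infsum k UNIV"
        and H' = "\<lambda>t x. gen k (H t) x"])
    fix x s S assume s: "0 < s" "0 < H s x" and S: "\<And>y. H s y \<le> S"
    show "gen k (H s) x \<le> infsum k UNIV * S"
      unfolding gen_def
    proof (rule infsum_kernel_mult_le[OF k])
      fix j
      show "\<bar>H s (x + j) - H s x\<bar> \<le> 2 * M"
        using H(1)[of s x] H(1)[of s "x + j"] s by simp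
      show "H s (x + j) - H s x \<le> S"
        using S[of "x + j"] s by simp
    qed
  qed (use H init \<open>0 \<le> t\<close> kernel_mass_nonneg[OF k] in \<open>auto simp: H_def abs_le_iff\<close>)
  then show ?thesis by (simp add: H_def)
qed

lemma heat_kernel_bounded_solution:
  assumes k: "jump_kernel k" and p: "heat_kernel k p"
  shows "bounded_solution k (\<lambda>t x. p t x y)"
  using p unfolding heat_kernel_def bounded_solution_def gen_def
  by (simp add: infsum_kernel_shift[OF k])

lemma heat_kernel_0: "heat_kernel k p \<Longrightarrow> p 0 x y = (if x = y then 1 else 0)"
  by (simp add: heat_kernel_def)

lemma heat_kernel_nonneg:
  assumes k: "jump_kernel k" and p: "heat_kernel k p" and "0 \<le> t"
  shows "0 \<le> p t x y"
  using bounded_solution_mono[OF k bounded_solution_const[of k 0]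
      heat_kernel_bounded_solution[OF k p] _ \<open>0 \<le> t\<close>, of y x]
  by (simp add: heat_kernel_0[OF p])

text \<open>Reflecting \<open>z \<mapsto> p t z x\<close> about the midpoint of \<open>x\<close> and \<open>y\<close> gives a bounded solution that starts from
the indicator of \<open>y\<close>, so it is \<open>z \<mapsto> p t z y\<close>; evaluate at \<open>z = x\<close>.\<close>
lemma heat_kernel_sym:
  assumes k: "jump_kernel k" and p: "heat_kernel k p" and "0 \<le> t"
  shows "p t x y = p t y x"
proof -
  note s = heat_kernel_bounded_solution[OF k p]
  note r = bounded_solution_reflect[OF k s[of x], of "y + x"]
  have "p t x y \<le> p t (y + x - x) x"
    by (rule bounded_solution_mono[OF k s r _ \<open>0 \<le> t\<close>]) (auto simp: heat_kernel_0[OF p])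
  moreover have "p t (y + x - x) x \<le> p t x y"
    by (rule bounded_solution_mono[OF k r s _ \<open>0 \<le> t\<close>]) (auto simp: heat_kernel_0[OF p])
  ultimately show ?thesis by simp
qed

text \<open>Summability of the kernel in its first argument is not known beforehand. By symmetry the sum runs
over the second argument instead; as a function of the first one it is then a bounded solution that
starts from an indicator function, and it stays below the solution \<open>1\<close>.\<close>
lemma heat_kernel_sum_le_1:
  assumes k: "jump_kernel k" and p: "heat_kernel k p" and "0 \<le> t" "finite A"
  shows "(\<Sum>z\<in>A. p t z y) \<le> 1"
proof -
  have "(\<Sum>z\<in>A. p t y z) \<le> 1"
    by (rule bounded_solution_mono[OF k bounded_solution_sum[OF k \<open>finite A\<close>]
          bounded_solution_const _ \<open>0 \<le> t\<close>])
      (auto simp: heat_kernel_0[OF p] \<open>finite A\<close> heat_kernel_bounded_solution[OF k p])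
  then show ?thesis by (simp add: heat_kernel_sym[OF k p \<open>0 \<le> t\<close>, of _ y])
qed

lemma heat_kernel_le_1:
  assumes "jump_kernel k" "heat_kernel k p" "0 \<le> t"
  shows "p t x y \<le> 1"
  using heat_kernel_sum_le_1[OF assms, of "{x}" y] by simp

lemma Psi_Upsilon_ge_neighbours:
  assumes k: "jump_kernel k" and v: "\<And>x. \<bar>v x\<bar> \<le> M"
  shows "k 1 * (Upsilon (v (x + 1) - v x) + Upsilon (v (x - 1) - v x)) \<le> Psi k Upsilon v x"
proof -
  have "(\<Sum>j\<in>{1, -1}. k j * Upsilon (v (x + j) - v x)) \<le> Psi k Upsilon v x"
    unfolding Psi_eq[OF k]
  proof (rule finite_sum_le_infsum)
    have "\<bar>Upsilon (v (x + j) - v x)\<bar> \<le> exp (2 * M) + 2 * M" for j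
      using v[of x] v[of "x + j"] by (intro Upsilon_bound) linarith
    then show "(\<lambda>j. k j * Upsilon (v (x + j) - v x)) summable_on UNIV"
      by (rule summable_kernel_mult[OF k])
  qed (use k Upsilon_nonneg in \<open>auto simp: jump_kernel_def\<close>)
  moreover have "k (- 1) = k 1" using k unfolding jump_kernel_def by metis
  ultimately show ?thesis by (simp add: distrib_left)
qed

text \<open>The logarithm of the heat kernel may be unbounded, whereas the curvature condition concerns bounded
functions only. The estimates are therefore applied to \<open>u = p + \<epsilon>\<close>, which solves the same equation and
has a bounded logarithm; as their constants do not involve \<open>\<epsilon>\<close>, letting \<open>\<epsilon> \<rightarrow> 0\<close> at the end is
harmless.\<close>
lemma heat_kernel_harnack:
  assumes k: "jump_kernel k" and k1: "0 < k 1" and p: "heat_kernel k p" and CD: "CD_Upsilon k F"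
    and Fmono: "\<And>r s. 0 < r \<Longrightarrow> r \<le> s \<Longrightarrow> F r \<le> F s"
    and \<phi>der: "\<And>s. 0 < s \<Longrightarrow> (\<phi> has_real_derivative \<phi>' s) (at s)"
    and \<phi>pos: "\<And>s. 0 < s \<Longrightarrow> 0 < \<phi> s"
    and super: "\<And>s. 0 < s \<Longrightarrow> - \<phi>' s \<le> 2 * F (\<phi> s)"
    and blowup: "filterlim \<phi> at_top (at_right 0)"
    and ab: "0 < a" "a < b"
  shows "p a x y \<le> p b z y * exp (integral {a..b} \<phi> + 2 * (real_of_int \<bar>x - z\<bar>)\<^sup>2 / (k 1 * (b - a)))"
    (is "_ \<le> _ * exp ?E")
proof -
  define \<Phi> where "\<Phi> = (\<lambda>s. integral {a..s} \<phi>)"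
  have \<Phi>: "\<Phi> b - \<Phi> a = integral {a..b} \<phi>" by (simp add: \<Phi>_def)
  have cont\<phi>: "continuous_on {a..b} \<phi>"
    using ab by (auto intro!: continuous_at_imp_continuous_on DERIV_isCont[OF \<phi>der])
  have cont\<Phi>: "continuous_on {a..b} \<Phi>"
    unfolding \<Phi>_def
    by (rule indefinite_integral_continuous_1[OF integrable_continuous_interval[OF cont\<phi>]])
  have der\<Phi>: "(\<Phi> has_real_derivative \<phi> s) (at s)" if "a < s" "s < b" for s
    using integral_has_real_derivative[OF cont\<phi>, of s] that
    by (simp add: \<Phi>_def at_within_Icc_at)
  have "p a x y + \<epsilon> \<le> (p b z y + \<epsilon>) * exp ?E" if "0 < \<epsilon>" for \<epsilon>
  proof -
    define u where "u = (\<lambda>t x. p t x y + 1 * \<epsilon>)"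
    define v where "v = (\<lambda>t x. ln (u t x))"
    have "bounded_solution k u"
      unfolding u_def
      by (rule bounded_solution_add_mult[OF k heat_kernel_bounded_solution[OF k p] bounded_solution_const])
    then have deru: "((\<lambda>s. u s x) has_real_derivative gen k (u t) x) (at t)" if "0 < t" for t x
      using that by (auto simp: bounded_solution_def)
    have u: "\<epsilon> \<le> u t x" "u t x \<le> 1 + \<epsilon>" if "0 < t" for t x
      using that heat_kernel_nonneg[OF k p, of t x y] heat_kernel_le_1[OF k p, of t x y]
      by (auto simp: u_def)
    have upos: "0 < u t x" if "0 < t" for t x using u(1)[OF that, of x] \<open>0 < \<epsilon>\<close> by linarith
    have v: "\<bar>v t x\<bar> \<le> \<bar>ln \<epsilon>\<bar> + \<bar>ln (1 + \<epsilon>)\<bar>" if "0 < t" for t x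
    proof -
      have "ln \<epsilon> \<le> v t x" "v t x \<le> ln (1 + \<epsilon>)"
        using u[OF that, of x] upos[OF that, of x] \<open>0 < \<epsilon>\<close> by (auto simp: v_def)
      then show ?thesis by linarith
    qed
    have derv: "((\<lambda>s. v s x) has_real_derivative gen k (v t) x + Psi k Upsilon (v t) x) (at t)"
      if "0 < t" for t x
    proof -
      have "((\<lambda>s. v s x) has_real_derivative gen k (u t) x / u t x) (at t)"
        unfolding v_def using upos[OF that, of x]
        by (auto intro!: derivative_eq_intros deru[OF that])
      moreover have "u t = (\<lambda>x. exp (v t x))" using upos[OF that] by (auto simp: v_def)
      ultimately show ?thesis using gen_div_eq_log[where v = "v t" and x = x, OF k v[OF that]] by simp
    qed
    have ly: "- gen k (v t) x \<le> \<phi> t" if "0 < t" for t x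
      by (rule li_yau[OF k CD Fmono v derv \<phi>der \<phi>pos super blowup that])
    have "v a x \<le> v b z + (\<Phi> b - \<Phi> a) + 2 * (real_of_int \<bar>x - z\<bar>)\<^sup>2 / (k 1 * (b - a))"
    proof (rule harnack_chain[OF ab(2) k1 _ cont\<Phi> _ der\<Phi>])
      show "continuous_on {a..b} (\<lambda>s. v s x)" for x
        using ab by (intro continuous_at_imp_continuous_on ballI DERIV_isCont[OF derv]) auto
      fix s x assume s: "a < s" "s < b"
      then have "0 < s" using ab by linarith
      then show "((\<lambda>s. v s x) has_real_derivative gen k (v s) x + Psi k Upsilon (v s) x) (at s)"
        by (rule derv)
      show "k 1 * (Upsilon (v s (x + 1) - v s x) + Upsilon (v s (x - 1) - v s x)) - \<phi> s
          \<le> gen k (v s) x + Psi k Upsilon (v s) x"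
        using ly[OF \<open>0 < s\<close>, of x]
          Psi_Upsilon_ge_neighbours[where v = "v s" and x = x, OF k v[OF \<open>0 < s\<close>]] by linarith
    qed
    then have "exp (v a x) \<le> exp (v b z + ?E)" by (simp add: \<Phi>)
    then show ?thesis
      using upos[of a x] upos[of b z] ab by (simp add: v_def exp_add u_def)
  qed
  then have *: "p a x y + \<epsilon> - (p b z y + \<epsilon>) * exp ?E \<le> 0" if "0 < \<epsilon>" for \<epsilon>
    using that by simp
  have "((\<lambda>\<epsilon>. p a x y + \<epsilon> - (p b z y + \<epsilon>) * exp ?E) \<longlongrightarrow> p a x y + 0 - (p b z y + 0) * exp ?E)
      (at_right 0)"
    by (intro tendsto_intros)
  moreover have "\<forall>\<^sub>F \<epsilon> in at_right 0. p a x y + \<epsilon> - (p b z y + \<epsilon>) * exp ?E \<le> 0"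
    using * by (auto simp: eventually_at_right_field intro: exI[of _ 1])
  ultimately have "p a x y + 0 - (p b z y + 0) * exp ?E \<le> 0"
    by (intro tendsto_upperbound) auto
  then show ?thesis by simp
qed

section \<open>An explicit supersolution\<close>

text \<open>A model lower bound for CD-functions: it behaves like \<open>(\<delta> r)\<^sup>\<gamma>\<close> at \<open>0\<close> and like \<open>exp (\<delta> r)\<close> at infinity,
and the substitution \<open>X = exp (\<delta> r) - 1\<close> turns the differential inequality for \<open>r\<close> into one between
powers of \<open>X\<close> and \<open>1 + X\<close>.\<close>
definition curvature_profile :: "real \<Rightarrow> real \<Rightarrow> real \<Rightarrow> real" where
  "curvature_profile \<gamma> \<delta> r = (exp (\<delta> * r) - 1) powr \<gamma> / exp (\<delta> * r) powr (\<gamma> - 1)"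

text \<open>The first summand dominates for small \<open>s\<close> and produces the logarithmic singularity, the second one
for large \<open>s\<close> and produces the decay \<open>t powr - (1 / (\<gamma> - 1))\<close>. A single smooth formula for all times avoids
gluing two solutions of the differential equation.\<close>
definition decay :: "real \<Rightarrow> real \<Rightarrow> real" where
  "decay \<gamma> s = 1 / s + s powr - (1 / (\<gamma> - 1))"

definition supersolution :: "real \<Rightarrow> real \<Rightarrow> real \<Rightarrow> real \<Rightarrow> real" where
  "supersolution \<gamma> \<delta> A t = ln (1 + decay \<gamma> (A * t)) / \<delta>"

lemma decay_pos: "0 < s \<Longrightarrow> 0 < decay \<gamma> s"
  by (simp add: decay_def add_pos_pos)

lemma supersolution_pos:
  assumes "0 < \<delta>" "0 < A" "0 < t"
  shows "0 < supersolution \<gamma> \<delta> A t"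
  using decay_pos[of "A * t" \<gamma>] assms by (simp add: supersolution_def)

lemma supersolution_has_derivative:
  assumes "0 < \<delta>" "0 < A" "0 < t"
  shows "(supersolution \<gamma> \<delta> A has_real_derivative
    - (1 / (A * t) + (A * t) powr - (1 / (\<gamma> - 1)) / (\<gamma> - 1))
      / (t * \<delta> * (1 + decay \<gamma> (A * t)))) (at t)"
proof -
  have X: "0 < decay \<gamma> (A * t)" using assms by (intro decay_pos) simp
  have "((\<lambda>t. 1 / (A * t) + (A * t) powr - b) has_real_derivative
      - (1 / (A * t) + (A * t) powr - b * b) / t) (at t)" for b
    using assms by (auto intro!: derivative_eq_intros simp: field_simps powr_diff)
  from this[of "1 / (\<gamma> - 1)"]
  have "((\<lambda>t. decay \<gamma> (A * t)) has_real_derivative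
      - (1 / (A * t) + (A * t) powr - (1 / (\<gamma> - 1)) / (\<gamma> - 1)) / t) (at t)"
    by (simp add: decay_def)
  then have "((\<lambda>t. ln (1 + decay \<gamma> (A * t)) / \<delta>) has_real_derivative
      - (1 / (A * t) + (A * t) powr - (1 / (\<gamma> - 1)) / (\<gamma> - 1)) / t
        / (1 + decay \<gamma> (A * t)) / \<delta>) (at t)"
    using assms X by (auto intro!: derivative_eq_intros)
  then show ?thesis
    unfolding supersolution_def[abs_def] by (simp add: mult_ac)
qed

text \<open>The algebraic core of the supersolution property. If \<open>X = decay \<gamma> s \<ge> 1\<close> then \<open>2 / (1 + X) \<ge> 1 / X\<close> and the
right-hand side is at least \<open>X \<ge> 1 / s\<close>; if \<open>X < 1\<close> then \<open>2 / (1 + X) \<ge> 1\<close> and it is at least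
\<open>X powr (\<gamma> - 1)\<close>, where the second summand of \<open>X\<close> suffices.\<close>
lemma inverse_le_decay_power:
  assumes "2 \<le> \<gamma>" "0 < s"
  shows "1 / s \<le> decay \<gamma> s powr (\<gamma> - 1) * (2 / (1 + decay \<gamma> s)) powr (\<gamma> - 2)"
proof -
  define X where "X = decay \<gamma> s"
  have X: "0 < X" using assms by (simp add: X_def decay_pos)
  show ?thesis
  proof (cases "1 \<le> X")
    case True
    have "1 / s \<le> X" using assms by (simp add: X_def decay_def)
    also have "X = X powr (\<gamma> - 1) * (1 / X) powr (\<gamma> - 2)"
      using X by (simp add: powr_divide powr_diff[symmetric] divide_simps flip: powr_add)
    also have "\<dots> \<le> X powr (\<gamma> - 1) * (2 / (1 + X)) powr (\<gamma> - 2)"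
      using X True assms by (intro mult_left_mono powr_mono2) (auto simp: field_simps)
    finally show ?thesis by (simp add: X_def)
  next
    case False
    have "1 / s = (s powr - (1 / (\<gamma> - 1))) powr (\<gamma> - 1)"
      using assms unfolding powr_powr by (simp add: powr_minus_divide)
    also have "\<dots> \<le> X powr (\<gamma> - 1)"
      using assms by (intro powr_mono2) (auto simp: X_def decay_def)
    also have "\<dots> \<le> X powr (\<gamma> - 1) * (2 / (1 + X)) powr (\<gamma> - 2)"
      using X False assms ge_one_powr_ge_zero[of "2 / (1 + X)" "\<gamma> - 2"]
      by (simp add: mult_le_cancel_left1)
    finally show ?thesis by (simp add: X_def)
  qed
qed

text \<open>The left-hand side is minus the derivative of the supersolution. The factor in front of the profile on
the right is the one for which \<open>inverse_le_decay_power\<close> closes the estimate.\<close>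
lemma supersolution_inequality:
  assumes "2 \<le> \<gamma>" "0 < \<delta>" "0 < A" "0 < t"
  shows "(1 / (A * t) + (A * t) powr - (1 / (\<gamma> - 1)) / (\<gamma> - 1))
      / (t * \<delta> * (1 + decay \<gamma> (A * t)))
    \<le> A * 2 powr (\<gamma> - 2) / \<delta> * curvature_profile \<gamma> \<delta> (supersolution \<gamma> \<delta> A t)"
proof -
  define X where "X = decay \<gamma> (A * t)"
  have X: "0 < X" using assms by (simp add: X_def decay_pos)
  have "1 / (A * t) + (A * t) powr - (1 / (\<gamma> - 1)) / (\<gamma> - 1) \<le> X"
    using assms by (simp add: X_def decay_def divide_le_eq mult_le_cancel_left1)
  then have "(1 / (A * t) + (A * t) powr - (1 / (\<gamma> - 1)) / (\<gamma> - 1)) / (t * \<delta> * (1 + X))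
      \<le> X / (t * \<delta> * (1 + X))"
    using assms X by (intro divide_right_mono) auto
  also have "\<dots> = 1 / (A * t) * (A * X / (\<delta> * (1 + X)))"
    using assms by (simp add: field_simps)
  also have "\<dots> \<le> (X powr (\<gamma> - 1) * (2 / (1 + X)) powr (\<gamma> - 2)) * (A * X / (\<delta> * (1 + X)))"
    using assms X unfolding X_def by (intro mult_right_mono inverse_le_decay_power) auto
  also have "\<dots> = A * 2 powr (\<gamma> - 2) / \<delta> * (X powr \<gamma> / (1 + X) powr (\<gamma> - 1))"
  proof -
    have "X powr \<gamma> = X powr (\<gamma> - 1) * X" using X powr_add[of X "\<gamma> - 1" 1] by simp
    moreover have "(1 + X) powr (\<gamma> - 1) = (1 + X) powr (\<gamma> - 2) * (1 + X)"
      using X powr_add[of "1 + X" "\<gamma> - 2" 1] by simp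
    ultimately show ?thesis using X assms by (simp add: powr_divide mult_ac)
  qed
  also have "X powr \<gamma> / (1 + X) powr (\<gamma> - 1)
      = curvature_profile \<gamma> \<delta> (supersolution \<gamma> \<delta> A t)"
    using X assms by (simp add: curvature_profile_def supersolution_def X_def)
  finally show ?thesis by (simp add: X_def)
qed

lemma supersolution_blowup:
  assumes "0 < \<delta>" "0 < A"
  shows "filterlim (supersolution \<gamma> \<delta> A) at_top (at_right 0)"
proof (rule filterlim_at_top_mono)
  show "filterlim (\<lambda>t. ln (1 / (A * t)) / \<delta>) at_top (at_right 0)"
    using assms by real_asymp
  have "ln (1 / (A * t)) / \<delta> \<le> supersolution \<gamma> \<delta> A t" if "0 < t" for t
  proof -
    have "ln (1 / (A * t)) \<le> ln (1 + decay \<gamma> (A * t))"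
      using assms that by (subst ln_le_cancel_iff) (auto simp: decay_def add_pos_pos)
    then show ?thesis using assms by (simp add: supersolution_def divide_right_mono)
  qed
  then show "\<forall>\<^sub>F t in at_right 0. ln (1 / (A * t)) / \<delta> \<le> supersolution \<gamma> \<delta> A t"
    by (auto simp: eventually_at_right_field intro: exI[of _ 1])
qed

lemma decay_le:
  assumes "2 \<le> \<gamma>" "1 \<le> s"
  shows "decay \<gamma> s \<le> 2 * s powr - (1 / (\<gamma> - 1))"
proof -
  have "1 / s = s powr (-1)" using assms by (simp add: powr_minus_divide)
  also have "\<dots> \<le> s powr - (1 / (\<gamma> - 1))" using assms by (intro powr_mono) auto
  finally show ?thesis by (simp add: decay_def)
qed

text \<open>For small \<open>s\<close> the logarithm is absorbed by the power because
\<open>ln (1 / s) = (\<gamma> - 1) ln (s powr - (1 / (\<gamma> - 1)))\<close> and \<open>ln P \<le> P - 1\<close>.\<close>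
lemma ln_1_decay_le:
  assumes "2 \<le> \<gamma>" "0 < s"
  shows "ln (1 + decay \<gamma> s) \<le> 3 * (\<gamma> - 1) * s powr - (1 / (\<gamma> - 1))"
proof (cases "1 \<le> s")
  case True
  have "ln (1 + decay \<gamma> s) \<le> decay \<gamma> s"
    using decay_pos[OF assms(2), of \<gamma>] by (intro ln_add_one_self_le_self) auto
  also have "\<dots> \<le> 2 * s powr - (1 / (\<gamma> - 1))" by (rule decay_le[OF assms(1) True])
  also have "\<dots> \<le> 3 * (\<gamma> - 1) * s powr - (1 / (\<gamma> - 1))"
    using assms by (intro mult_right_mono) auto
  finally show ?thesis .
next
  case False
  define P where "P = s powr - (1 / (\<gamma> - 1))"
  have P: "1 \<le> P" "P \<le> 1 / s"
  proof -
    have "s powr 0 \<le> P" unfolding P_def using assms False by (intro powr_mono') auto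
    then show "1 \<le> P" using assms by simp
    have "P \<le> s powr (-1)" unfolding P_def using assms False by (intro powr_mono') auto
    then show "P \<le> 1 / s" using assms by (simp add: powr_minus_divide)
  qed
  have "1 + decay \<gamma> s \<le> 3 * (1 / s)"
    using P unfolding decay_def P_def by linarith
  then have "ln (1 + decay \<gamma> s) \<le> ln (3 * (1 / s))"
    using decay_pos[OF assms(2), of \<gamma>] assms by (subst ln_le_cancel_iff) auto
  also have "\<dots> = ln 3 + ln (1 / s)" using assms by (subst ln_mult) auto
  also have "ln (1 / s) = (\<gamma> - 1) * ln P"
    using assms by (simp add: P_def ln_powr ln_div)
  also have "\<dots> \<le> (\<gamma> - 1) * P"
    using assms P ln_le_minus_one[of P] by (intro mult_left_mono) auto
  also have "ln 3 \<le> (2 :: real)" using ln_le_minus_one[of "3 :: real"] by simp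
  also have "2 \<le> 2 * ((\<gamma> - 1) * P)"
    using assms P mult_mono[of 1 "\<gamma> - 1" 1 P] by simp
  finally show ?thesis by (simp add: P_def algebra_simps)
qed

text \<open>The factor \<open>2 powr \<gamma> * c * \<delta> powr (1 - \<gamma>)\<close> is the one inside the logarithm of \<^const>\<open>Lam\<close>. Running the
supersolution faster by \<open>4 powr (\<gamma> - 1) * exp 2\<close> leaves enough room to bound it by the derivative of
\<^const>\<open>Lam\<close> both before and after \<^const>\<open>t_star\<close>; it costs only a smaller constant \<open>c\<close>.\<close>
definition time_scale :: "real \<Rightarrow> real \<Rightarrow> real \<Rightarrow> real" where
  "time_scale c \<gamma> \<delta> = 2 powr \<gamma> * c * \<delta> powr (1 - \<gamma>) * (4 powr (\<gamma> - 1) * exp 2)"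

lemma time_scale_pos: "0 < c \<Longrightarrow> 0 < \<delta> \<Longrightarrow> 0 < time_scale c \<gamma> \<delta>"
  by (simp add: time_scale_def)

lemma t_star_pos: "0 < c \<Longrightarrow> 0 < \<delta> \<Longrightarrow> 0 < t_star c \<gamma> \<delta>"
  by (simp add: t_star_def)

lemma le_t_star_iff:
  assumes "0 < c" "0 < \<delta>"
  shows "t \<le> t_star c \<gamma> \<delta> \<longleftrightarrow> 2 powr \<gamma> * c * \<delta> powr (1 - \<gamma>) * t \<le> exp (- 2)"
    and "t_star c \<gamma> \<delta> \<le> t \<longleftrightarrow> exp (- 2) \<le> 2 powr \<gamma> * c * \<delta> powr (1 - \<gamma>) * t"
  using assms by (simp_all add: t_star_def powr_diff exp_minus field_simps)

text \<open>With \<open>s\<close> the argument of the logarithm and \<open>E\<close> the additional speed, the claim is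
\<open>s (1 + decay \<gamma> (s E)) \<le> 1\<close>. Each of the three summands \<open>s\<close>, \<open>1 / E\<close>, \<open>s (s E) powr - \<beta>\<close> is at most
\<open>1 / 4\<close>.\<close>
lemma supersolution_le_early:
  assumes "2 \<le> \<gamma>" "0 < \<delta>" "0 < c" "0 < t" "t \<le> t_star c \<gamma> \<delta>"
  shows "supersolution \<gamma> \<delta> (time_scale c \<gamma> \<delta>) t
    \<le> - ln (2 powr \<gamma> * c * \<delta> powr (1 - \<gamma>) * t) / \<delta>"
proof -
  define s where "s = 2 powr \<gamma> * c * \<delta> powr (1 - \<gamma>) * t"
  define E where "E = 4 powr (\<gamma> - 1) * exp (2::real)"
  define \<beta> where "\<beta> = 1 / (\<gamma> - 1)"
  have \<beta>: "0 < \<beta>" "\<beta> \<le> 1" using assms by (auto simp: \<beta>_def)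
  have s: "0 < s" using assms by (simp add: s_def)
  have e: "exp (- 2) \<le> (1 / 4 :: real)"
    using exp_ge_add_one_self[of 1] power_mono[of 2 "exp 1 :: real" 2]
    by (simp add: exp_minus field_simps exp_of_nat_mult[symmetric] flip: exp_double)
  have s4: "s \<le> 1 / 4" using le_t_star_iff(1)[of c \<delta> t \<gamma>] assms e by (simp add: s_def)
  have "4 powr 1 \<le> 4 powr (\<gamma> - 1)" using assms by (intro powr_mono) auto
  then have "4 * 1 \<le> E" unfolding E_def by (intro mult_mono) auto
  then have E: "4 \<le> E" by simp
  have "s * (s * E) powr - \<beta> = s powr (1 - \<beta>) * E powr - \<beta>"
    using s E by (simp add: powr_mult powr_diff powr_minus field_simps)
  also have "\<dots> \<le> 1 * (1 / 4)"
  proof (rule mult_mono)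
    show "s powr (1 - \<beta>) \<le> 1" using s s4 \<beta> by (intro powr_le1) auto
    have "(4 powr (\<gamma> - 1)) powr \<beta> \<le> E powr \<beta>"
      using \<beta> by (intro powr_mono2) (auto simp: E_def)
    moreover have "(4 powr (\<gamma> - 1)) powr \<beta> = 4"
      using assms by (simp add: powr_powr \<beta>_def)
    ultimately have "4 \<le> E powr \<beta>" by simp
    then show "E powr - \<beta> \<le> 1 / 4"
      unfolding powr_minus_divide by (intro divide_left_mono) auto
  qed auto
  finally have "s * (s * E) powr - \<beta> \<le> 1 / 4" by simp
  moreover have "s * (1 / (s * E)) \<le> 1 / 4" using E s by (simp add: field_simps)
  ultimately have "s * (1 + decay \<gamma> (s * E)) \<le> 1"
    using s4 by (simp add: decay_def \<beta>_def distrib_left)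
  then have "1 + decay \<gamma> (s * E) \<le> 1 / s" using s by (simp add: field_simps)
  then have "ln (1 + decay \<gamma> (s * E)) \<le> ln (1 / s)"
    using decay_pos[of "s * E" \<gamma>] s E by (subst ln_le_cancel_iff) (auto simp: add_pos_pos)
  also have "\<dots> = - ln s" using s by (simp add: ln_div)
  also have "s * E = time_scale c \<gamma> \<delta> * t" by (simp add: s_def E_def time_scale_def)
  finally show ?thesis
    using assms unfolding supersolution_def s_def by (intro divide_right_mono) auto
qed

text \<open>At these times the argument of \<^const>\<open>decay\<close> is at least \<open>1\<close>, so the power term dominates, and
comparing it with the target reduces to \<open>\<gamma> - 1 \<le> 2 * 4 powr (\<gamma> - 1)\<close>.\<close>
lemma supersolution_le_late:
  assumes "2 \<le> \<gamma>" "0 < \<delta>" "0 < c" "t_star c \<gamma> \<delta> \<le> t"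
  shows "supersolution \<gamma> \<delta> (time_scale c \<gamma> \<delta>) t
    \<le> ((\<gamma> - 1) * (c * exp 2 * t)) powr - (1 / (\<gamma> - 1))"
proof -
  define s where "s = time_scale c \<gamma> \<delta> * t"
  have t: "0 < t" using t_star_pos[of c \<delta> \<gamma>] assms by linarith
  have "exp (- 2) * (4 powr (\<gamma> - 1) * exp 2)
      \<le> (2 powr \<gamma> * c * \<delta> powr (1 - \<gamma>) * t) * (4 powr (\<gamma> - 1) * exp 2)"
    using assms le_t_star_iff(2)[of c \<delta> \<gamma> t] by (intro mult_right_mono) auto
  then have "4 powr (\<gamma> - 1) \<le> s"
    by (simp add: s_def time_scale_def mult_ac exp_minus divide_simps)
  moreover have "1 \<le> 4 powr (\<gamma> - 1)" using assms by (intro ge_one_powr_ge_zero) auto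
  ultimately have s: "1 \<le> s" by linarith
  have "\<gamma> - 1 \<le> 2 * 4 powr (\<gamma> - 1)"
  proof -
    have "\<gamma> - 1 \<le> (\<gamma> - 1) * ln 4" using assms ln_ge_iff[of 4 1] e_less_272 by (simp add: mult_le_cancel_left1)
    also have "\<dots> \<le> exp ((\<gamma> - 1) * ln 4)" using exp_ge_add_one_self[of "(\<gamma> - 1) * ln 4"] by linarith
    also have "\<dots> = 4 powr (\<gamma> - 1)" by (simp add: powr_def)
    finally show ?thesis using powr_ge_zero[of 4 "\<gamma> - 1"] by linarith
  qed
  have "ln (1 + decay \<gamma> s) \<le> decay \<gamma> s"
    using decay_pos[of s \<gamma>] s by (intro ln_add_one_self_le_self) auto
  also have "\<dots> \<le> 2 * s powr - (1 / (\<gamma> - 1))" by (rule decay_le[OF assms(1) s])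
  finally have "supersolution \<gamma> \<delta> (time_scale c \<gamma> \<delta>) t \<le> 2 / \<delta> * s powr - (1 / (\<gamma> - 1))"
    using assms by (simp add: supersolution_def s_def divide_right_mono)
  also have "2 / \<delta> = ((2 / \<delta>) powr (1 - \<gamma>)) powr - (1 / (\<gamma> - 1))"
  proof -
    have "(1 - \<gamma>) * - (1 / (\<gamma> - 1)) = 1" using assms by (simp add: field_simps)
    then show ?thesis using assms unfolding powr_powr by simp
  qed
  also have "\<dots> * s powr - (1 / (\<gamma> - 1)) = ((2 / \<delta>) powr (1 - \<gamma>) * s) powr - (1 / (\<gamma> - 1))"
    using s assms by (simp add: powr_mult)
  also have "(2 / \<delta>) powr (1 - \<gamma>) * s = 2 * 4 powr (\<gamma> - 1) * (c * exp 2 * t)"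
    using assms by (simp add: s_def time_scale_def powr_divide powr_diff field_simps)
  also have "\<dots> powr - (1 / (\<gamma> - 1)) \<le> ((\<gamma> - 1) * (c * exp 2 * t)) powr - (1 / (\<gamma> - 1))"
    using assms t \<open>\<gamma> - 1 \<le> 2 * 4 powr (\<gamma> - 1)\<close>
    by (intro powr_mono2' mult_right_mono) auto
  finally show ?thesis .
qed

section \<open>Lower bounds for CD-functions\<close>
lemma CD_function_pos:
  assumes "CD_function F" "0 < r"
  shows "0 < F r"
proof -
  have "F (r / 2) / (r / 2) < F r / r"
    using assms by (intro strict_mono_onD[of "{0<..}" "\<lambda>r. F r / r"]) (auto simp: CD_function_def)
  moreover have "0 \<le> F (r / 2)" using assms by (auto simp: CD_function_def)
  ultimately have "0 < F r / r" using assms(2)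
    by (meson divide_nonneg_pos half_gt_zero le_less_trans)
  then show ?thesis using assms(2) by (simp add: zero_less_divide_iff)
qed

lemma CD_function_mono:
  assumes F: "CD_function F" and rs: "0 < r" "r \<le> s"
  shows "F r \<le> F s"
proof (cases "r = s")
  case False
  have "F r / r < F s / s"
    using F rs False
    by (intro strict_mono_onD[of "{0<..}" "\<lambda>r. F r / r"]) (auto simp: CD_function_def)
  then have "F r < r * (F s / s)" using rs by (simp add: field_simps)
  also have "\<dots> \<le> s * (F s / s)"
    using rs CD_function_pos[OF F, of s] by (intro mult_right_mono) auto
  finally show ?thesis using rs by simp
qed simp

lemma asymp_equiv_imp_ge_half:
  fixes f g :: "'a \<Rightarrow> real"
  assumes "f \<sim>[\<F>] g" "\<forall>\<^sub>F x in \<F>. 0 < g x"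
  shows "\<forall>\<^sub>F x in \<F>. g x / 2 \<le> f x"
proof -
  have "\<forall>\<^sub>F x in \<F>. 1 / 2 < (if f x = 0 \<and> g x = 0 then 1 else f x / g x)"
    using assms(1) by (intro order_tendstoD(1)[of _ 1]) (auto simp: asymp_equiv_def)
  then show ?thesis
    using assms(2) by eventually_elim (auto simp: field_simps)
qed

lemma asymp_equiv_not_dominated:
  fixes f g :: "'a \<Rightarrow> real"
  assumes "f \<sim>[\<F>] g" "\<forall>\<^sub>F x in \<F>. 0 < g x" "\<F> \<noteq> bot"
  shows "\<not> filterlim (\<lambda>x. f x / g x) at_top \<F>"
proof
  assume lim: "filterlim (\<lambda>x. f x / g x) at_top \<F>"
  have "\<forall>\<^sub>F x in \<F>. (if f x = 0 \<and> g x = 0 then 1 else f x / g x) = f x / g x"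
    using assms(2) by eventually_elim auto
  then have "((\<lambda>x. f x / g x) \<longlongrightarrow> 1) \<F>"
    using assms(1) unfolding asymp_equiv_def by (simp add: tendsto_cong)
  then show False
    using lim assms(3) not_tendsto_and_filterlim_at_infinity filterlim_at_top_imp_at_infinity by blast
qed

text \<open>The constant of the theorem may depend on \<open>F\<close> alone, while the estimates involve \<open>\<gamma>\<close> and \<open>\<delta>\<close>. This is
consistent because both exponents can be read off from the asymptotics of \<open>F\<close>.\<close>
lemma power_exponent_unique:
  assumes "F \<sim>[at_right 0] (\<lambda>x. c * x powr p)" "F \<sim>[at_right 0] (\<lambda>x. d * x powr q)"
    and "0 < c" "0 < (d::real)"
  shows "p = q"
proof -
  have "p \<ge> q" if "(\<lambda>x. c * x powr p) \<sim>[at_right 0] (\<lambda>x. d * x powr q)" "0 < c" "0 < d"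
    for c d p q :: real
  proof (rule ccontr)
    assume "\<not> q \<le> p"
    then have "0 < q - p" by simp
    have "\<forall>\<^sub>F x in at_right 0. 0 < d * x powr q"
      using \<open>0 < d\<close> by (auto simp: eventually_at_right_field intro: exI[of _ 1])
    from asymp_equiv_not_dominated[OF that(1) this]
    have "\<not> filterlim (\<lambda>x. c * x powr p / (d * x powr q)) at_top (at_right 0)" by simp
    moreover have "filterlim (\<lambda>x. c / d * x powr - (q - p)) at_top (at_right 0)"
      using that(2,3) \<open>0 < q - p\<close> by real_asymp
    then have "filterlim (\<lambda>x. c * x powr p / (d * x powr q)) at_top (at_right 0)"
      by (simp add: powr_diff)
    ultimately show False by blast
  qed
  note le = this
  note eq = asymp_equiv_trans[OF asymp_equiv_symI[OF assms(1)] assms(2)]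
  show ?thesis
    using le[OF eq] le[OF asymp_equiv_symI[OF eq]] assms(3,4) by simp
qed

lemma exponential_rate_unique:
  assumes "F \<sim>[at_top] (\<lambda>x. c * exp (p * x))" "F \<sim>[at_top] (\<lambda>x. d * exp (q * x))"
    and "0 < c" "0 < (d::real)"
  shows "p = q"
proof -
  have "p \<le> q" if "(\<lambda>x. c * exp (p * x)) \<sim>[at_top] (\<lambda>x. d * exp (q * x))" "0 < c" "0 < d"
    for c d p q :: real
  proof (rule ccontr)
    assume "\<not> p \<le> q"
    then have "0 < p - q" by simp
    have "\<forall>\<^sub>F x in at_top. 0 < d * exp (q * x)" using \<open>0 < d\<close> by simp
    from asymp_equiv_not_dominated[OF that(1) this]
    have "\<not> filterlim (\<lambda>x. c * exp (p * x) / (d * exp (q * x))) at_top at_top" by simp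
    moreover have "filterlim (\<lambda>x. c / d * exp ((p - q) * x)) at_top at_top"
      using that(2,3) \<open>0 < p - q\<close> by real_asymp
    then have "filterlim (\<lambda>x. c * exp (p * x) / (d * exp (q * x))) at_top at_top"
      by (simp add: exp_diff left_diff_distrib)
    ultimately show False by blast
  qed
  note le = this
  note eq = asymp_equiv_trans[OF asymp_equiv_symI[OF assms(1)] assms(2)]
  show ?thesis
    using le[OF eq] le[OF asymp_equiv_symI[OF eq]] assms(3,4) by simp
qed

lemma curvature_profile_le_exp:
  assumes "0 < \<gamma>" "0 < \<delta>" "0 < r"
  shows "curvature_profile \<gamma> \<delta> r \<le> exp (\<delta> * r)"
proof -
  have "(exp (\<delta> * r) - 1) powr \<gamma> \<le> exp (\<delta> * r) powr \<gamma>"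
    using assms by (intro powr_mono2) auto
  also have "\<dots> = exp (\<delta> * r) * exp (\<delta> * r) powr (\<gamma> - 1)"
    by (simp add: powr_diff)
  finally show ?thesis by (simp add: curvature_profile_def divide_le_eq)
qed

lemma curvature_profile_le_power:
  assumes "1 \<le> \<gamma>" "0 < \<delta>" "0 < r" "\<delta> * r \<le> 1"
  shows "curvature_profile \<gamma> \<delta> r \<le> (2 * \<delta>) powr \<gamma> * r powr \<gamma>"
proof -
  have "exp (\<delta> * r) \<le> 1 + \<delta> * r + (\<delta> * r)\<^sup>2" using assms by (intro exp_bound) auto
  also have "(\<delta> * r)\<^sup>2 \<le> \<delta> * r"
    using assms by (simp add: power2_eq_square mult_le_cancel_right1 mult_left_le)
  finally have "exp (\<delta> * r) - 1 \<le> 2 * \<delta> * r" by simp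
  then have "(exp (\<delta> * r) - 1) powr \<gamma> \<le> (2 * \<delta> * r) powr \<gamma>"
    using assms by (intro powr_mono2) auto
  moreover have "1 \<le> exp (\<delta> * r) powr (\<gamma> - 1)"
    using assms by (intro ge_one_powr_ge_zero) auto
  then have "curvature_profile \<gamma> \<delta> r \<le> (exp (\<delta> * r) - 1) powr \<gamma> / 1"
    unfolding curvature_profile_def by (intro divide_left_mono) auto
  ultimately show ?thesis using assms by (simp add: powr_mult)
qed

text \<open>The two asymptotics control \<open>F\<close> near \<open>0\<close> and near infinity; between these regions \<open>F\<close> is bounded below by
monotonicity and the profile is bounded above.\<close>
lemma CD_function_ge_profile:
  assumes F: "CD_function F" and "2 \<le> \<gamma>" "0 < \<delta>" "0 < c1" "0 < c2"
    and F0: "F \<sim>[at_right 0] (\<lambda>x. c1 * x powr \<gamma>)"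
    and Finf: "F \<sim>[at_top] (\<lambda>x. c2 * exp (\<delta> * x))"
  shows "\<exists>\<kappa>>0. \<forall>r>0. \<kappa> * curvature_profile \<gamma> \<delta> r \<le> F r"
proof -
  have "\<forall>\<^sub>F x in at_right 0. c1 * x powr \<gamma> / 2 \<le> F x"
    using \<open>0 < c1\<close> by (intro asymp_equiv_imp_ge_half[OF F0])
      (auto simp: eventually_at_right_field intro: exI[of _ 1])
  then obtain b where b: "0 < b" "\<And>r. 0 < r \<Longrightarrow> r < b \<Longrightarrow> c1 * r powr \<gamma> / 2 \<le> F r"
    unfolding eventually_at_right_field by auto
  define r0 where "r0 = min b (1 / \<delta>)"
  have r0: "0 < r0" "r0 \<le> b" "r0 \<le> 1 / \<delta>" using b \<open>0 < \<delta>\<close> by (auto simp: r0_def)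
  have "\<forall>\<^sub>F x in at_top. c2 * exp (\<delta> * x) / 2 \<le> F x"
    using \<open>0 < c2\<close> by (intro asymp_equiv_imp_ge_half[OF Finf]) auto
  then obtain r1 where r1: "\<And>r. r1 \<le> r \<Longrightarrow> c2 * exp (\<delta> * r) / 2 \<le> F r"
    unfolding eventually_at_top_linorder by auto
  define \<kappa> where "\<kappa> = min (c1 / 2 / (2 * \<delta>) powr \<gamma>) (min (c2 / 2) (F r0 / exp (\<delta> * r1)))"
  have \<kappa>: "0 < \<kappa>" "\<kappa> \<le> c1 / 2 / (2 * \<delta>) powr \<gamma>" "\<kappa> \<le> c2 / 2" "\<kappa> \<le> F r0 / exp (\<delta> * r1)"
    using assms(3-5) CD_function_pos[OF F r0(1)] unfolding \<kappa>_def by (simp, linarith+)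
  have "\<kappa> * curvature_profile \<gamma> \<delta> r \<le> F r" if "0 < r" for r
  proof -
    have le_exp: "curvature_profile \<gamma> \<delta> r \<le> exp (\<delta> * r)"
      using assms that by (intro curvature_profile_le_exp) auto
    consider "r < r0" | "r0 \<le> r" "r < r1" | "r1 \<le> r" by linarith
    then show ?thesis
    proof cases
      case 1
      have "\<delta> * r \<le> \<delta> * (1 / \<delta>)" using 1 r0 \<open>0 < \<delta>\<close> by (intro mult_left_mono) auto
      then have "\<delta> * r \<le> 1" using \<open>0 < \<delta>\<close> by simp
      then have "\<kappa> * curvature_profile \<gamma> \<delta> r \<le> (c1 / 2 / (2 * \<delta>) powr \<gamma>) * ((2 * \<delta>) powr \<gamma> * r powr \<gamma>)"
        using assms that \<kappa> by (intro mult_mono curvature_profile_le_power) (auto simp: curvature_profile_def)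
      also have "\<dots> = c1 * r powr \<gamma> / 2" using assms by simp
      also have "\<dots> \<le> F r" using b(2)[of r] that 1 r0 by simp
      finally show ?thesis .
    next
      case 2
      have "\<kappa> * curvature_profile \<gamma> \<delta> r \<le> F r0 / exp (\<delta> * r1) * exp (\<delta> * r)"
        using \<kappa> by (intro mult_mono le_exp) (auto simp: curvature_profile_def)
      also have "\<dots> \<le> F r0 / exp (\<delta> * r1) * exp (\<delta> * r1)"
        using 2 \<open>0 < \<delta>\<close> CD_function_pos[OF F r0(1)] by (intro mult_left_mono) auto
      also have "\<dots> = F r0" by simp
      also have "\<dots> \<le> F r" using 2 r0 by (intro CD_function_mono[OF F]) auto
      finally show ?thesis .
    next
      case 3
      have "\<kappa> * curvature_profile \<gamma> \<delta> r \<le> c2 / 2 * exp (\<delta> * r)"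
        using \<kappa> \<open>0 < c2\<close> by (intro mult_mono le_exp) (auto simp: curvature_profile_def)
      also have "\<dots> \<le> F r" using r1[OF 3] by simp
      finally show ?thesis .
    qed
  qed
  then show ?thesis using \<kappa>(1) by blast
qed

text \<open>The factor is that of \<open>supersolution_inequality\<close> for the speed \<open>time_scale c \<gamma> \<delta>\<close>.\<close>
definition dominates_profile :: "(real \<Rightarrow> real) \<Rightarrow> real \<Rightarrow> real \<Rightarrow> real \<Rightarrow> bool" where
  "dominates_profile F \<gamma> \<delta> c \<longleftrightarrow>
     (\<forall>r>0. time_scale c \<gamma> \<delta> * 2 powr (\<gamma> - 2) / \<delta> * curvature_profile \<gamma> \<delta> r \<le> F r)"

definition admissible :: "(real \<Rightarrow> real) \<Rightarrow> real \<Rightarrow> real \<Rightarrow> real \<Rightarrow> real \<Rightarrow> bool" where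
  "admissible F \<gamma> \<delta> c1 c2 \<longleftrightarrow>
     CD_function F \<and> 2 \<le> \<gamma> \<and> 0 < \<delta> \<and> 0 < c1 \<and> 0 < c2 \<and>
     F \<sim>[at_right 0] (\<lambda>x. c1 * x powr \<gamma>) \<and> F \<sim>[at_top] (\<lambda>x. c2 * exp (\<delta> * x))"

text \<open>The profile factor is linear in \<open>c\<close>, so any lower bound of the form \<open>\<kappa> * curvature_profile \<gamma> \<delta> r\<close>
determines a suitable \<open>c\<close>.\<close>
lemma ex_dominating_constant:
  "\<exists>c>0. \<forall>\<gamma> \<delta> c1 c2. admissible F \<gamma> \<delta> c1 c2 \<longrightarrow> dominates_profile F \<gamma> \<delta> c"
proof (cases "\<exists>\<gamma> \<delta> c1 c2. admissible F \<gamma> \<delta> c1 c2")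
  case True
  then obtain \<gamma> \<delta> c1 c2 where adm: "admissible F \<gamma> \<delta> c1 c2" by blast
  then obtain \<kappa> where \<kappa>: "0 < \<kappa>" "\<forall>r>0. \<kappa> * curvature_profile \<gamma> \<delta> r \<le> F r"
    unfolding admissible_def using CD_function_ge_profile by metis
  have "0 < \<delta>" using adm by (simp add: admissible_def)
  define D where "D = time_scale 1 \<gamma> \<delta> * 2 powr (\<gamma> - 2) / \<delta>"
  have "0 < D" using \<open>0 < \<delta>\<close> time_scale_pos[of 1 \<delta> \<gamma>] by (simp add: D_def)
  have "time_scale (\<kappa> / D) \<gamma> \<delta> * 2 powr (\<gamma> - 2) / \<delta> = \<kappa> / D * D"
    by (simp add: D_def time_scale_def)
  then have dom: "dominates_profile F \<gamma> \<delta> (\<kappa> / D)"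
    using \<kappa>(2) \<open>0 < D\<close> by (simp add: dominates_profile_def)
  have "dominates_profile F \<gamma>' \<delta>' (\<kappa> / D)" if adm': "admissible F \<gamma>' \<delta>' c1' c2'" for \<gamma>' \<delta>' c1' c2'
  proof -
    have "\<gamma>' = \<gamma>"
      by (rule power_exponent_unique[of F c1' \<gamma>' c1 \<gamma>])
        (use adm adm' in \<open>simp_all add: admissible_def\<close>)
    moreover have "\<delta>' = \<delta>"
      by (rule exponential_rate_unique[of F c2' \<delta>' c2 \<delta>])
        (use adm adm' in \<open>simp_all add: admissible_def\<close>)
    ultimately show ?thesis using dom by simp
  qed
  moreover have "0 < \<kappa> / D" using \<kappa>(1) \<open>0 < D\<close> by simp
  ultimately show ?thesis by blast
next
  case False
  then show ?thesis by (blast intro: zero_less_one)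
qed

section \<open>Integrating the supersolution\<close>
lemma integral_le_increment:
  fixes f g G :: "real \<Rightarrow> real"
  assumes "a \<le> b" "continuous_on {a..b} f"
    and der: "\<And>s. a \<le> s \<Longrightarrow> s \<le> b \<Longrightarrow> (G has_real_derivative g s) (at s)"
    and le: "\<And>s. a \<le> s \<Longrightarrow> s \<le> b \<Longrightarrow> f s \<le> g s"
  shows "integral {a..b} f \<le> G b - G a"
proof (rule has_integral_le)
  show "(f has_integral integral {a..b} f) {a..b}"
    using assms(2) by (intro integrable_integral integrable_continuous_interval)
  show "(g has_integral G b - G a) {a..b}"
    using der by (intro fundamental_theorem_of_calculus[OF \<open>a \<le> b\<close>])
      (auto simp: has_real_derivative_iff_has_vector_derivative[symmetric] intro: DERIV_subset)
qed (use le in auto)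

lemma continuous_on_supersolution:
  assumes "0 < \<delta>" "0 < A" "0 < a"
  shows "continuous_on {a..b} (supersolution \<gamma> \<delta> A)"
  using assms
  by (intro continuous_at_imp_continuous_on ballI DERIV_isCont[OF supersolution_has_derivative]) auto

definition Lam_early :: "real \<Rightarrow> real \<Rightarrow> real \<Rightarrow> real \<Rightarrow> real" where
  "Lam_early c \<gamma> \<delta> t = t / \<delta> * (1 - ln (2 powr \<gamma> * c * \<delta> powr (1 - \<gamma>) * t))"

definition Lam_late :: "real \<Rightarrow> real \<Rightarrow> real \<Rightarrow> real" where
  "Lam_late c \<gamma> t =
     (if \<gamma> = 2 then ln t / (c * exp 2)
      else ((\<gamma> - 1) * t) powr ((\<gamma> - 2) / (\<gamma> - 1))
             / ((c * exp 2) powr (1 / (\<gamma> - 1)) * (\<gamma> - 2)))"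

text \<open>The additive constant for which \<^const>\<open>Lam\<close> is continuous at \<^const>\<open>t_star\<close>. It serves as \<open>\<tau>\<^sub>1\<close> if \<open>\<gamma> = 2\<close>
and as \<open>\<tau>\<^sub>2\<close> if \<open>\<gamma> > 2\<close>.\<close>
definition Lam_offset :: "real \<Rightarrow> real \<Rightarrow> real \<Rightarrow> real" where
  "Lam_offset c \<gamma> \<delta> = Lam_early c \<gamma> \<delta> (t_star c \<gamma> \<delta>) - Lam_late c \<gamma> (t_star c \<gamma> \<delta>)"

lemma Lam_eq:
  "Lam c \<gamma> \<delta> (Lam_offset c \<gamma> \<delta>) (Lam_offset c \<gamma> \<delta>) t =
    (if t \<le> t_star c \<gamma> \<delta> then Lam_early c \<gamma> \<delta> t
     else Lam_early c \<gamma> \<delta> (t_star c \<gamma> \<delta>) + (Lam_late c \<gamma> t - Lam_late c \<gamma> (t_star c \<gamma> \<delta>)))"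
  by (simp add: Lam_def Lam_offset_def Lam_early_def Lam_late_def)

lemma Lam_early_has_derivative:
  assumes "0 < c" "0 < \<delta>" "0 < t"
  shows "(Lam_early c \<gamma> \<delta> has_real_derivative
    - ln (2 powr \<gamma> * c * \<delta> powr (1 - \<gamma>) * t) / \<delta>) (at t)"
  unfolding Lam_early_def[abs_def] using assms
  by (auto intro!: derivative_eq_intros simp: field_simps)

lemma Lam_late_has_derivative:
  assumes "2 \<le> \<gamma>" "0 < c" "0 < t"
  shows "(Lam_late c \<gamma> has_real_derivative ((\<gamma> - 1) * (c * exp 2 * t)) powr - (1 / (\<gamma> - 1))) (at t)"
proof (cases "\<gamma> = 2")
  case True
  then show ?thesis
    unfolding Lam_late_def[abs_def] using assms
    by (auto intro!: derivative_eq_intros simp: powr_minus field_simps)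
next
  case False
  define q where "q = (\<gamma> - 2) / (\<gamma> - 1)"
  define Q where "Q = (c * exp 2) powr (1 / (\<gamma> - 1))"
  have q: "q - 1 = - (1 / (\<gamma> - 1))" "q * (\<gamma> - 1) = \<gamma> - 2"
    using assms by (simp_all add: q_def field_simps)
  have "0 < Q" using assms by (simp add: Q_def)
  have "((\<lambda>t. ((\<gamma> - 1) * t) powr q / (Q * (\<gamma> - 2))) has_real_derivative
      q * ((\<gamma> - 1) * t) powr (q - 1) * (\<gamma> - 1) / (Q * (\<gamma> - 2))) (at t)"
    using assms False \<open>0 < Q\<close> by (auto intro!: derivative_eq_intros)
  also have "q * ((\<gamma> - 1) * t) powr (q - 1) * (\<gamma> - 1) / (Q * (\<gamma> - 2))
      = (q * (\<gamma> - 1)) * ((\<gamma> - 1) * t) powr (q - 1) / (Q * (\<gamma> - 2))"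
    by simp
  also have "\<dots> = ((\<gamma> - 1) * t) powr (q - 1) / Q"
    unfolding q(2) using False by simp
  also have "\<dots> = ((\<gamma> - 1) * t) powr - (1 / (\<gamma> - 1)) * (c * exp 2) powr - (1 / (\<gamma> - 1))"
    unfolding q(1) Q_def powr_minus_divide[of "c * exp 2"] by simp
  also have "\<dots> = ((\<gamma> - 1) * (c * exp 2 * t)) powr - (1 / (\<gamma> - 1))"
    using assms by (simp add: mult_ac flip: powr_mult)
  finally show ?thesis
    using False by (simp add: Lam_late_def[abs_def] q_def Q_def)
qed

lemma Lam_late_mono:
  assumes "2 \<le> \<gamma>" "0 < c" "0 < s" "s \<le> t"
  shows "Lam_late c \<gamma> s \<le> Lam_late c \<gamma> t"
proof (rule DERIV_nonneg_imp_nondecreasing[OF \<open>s \<le> t\<close>])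
  fix x assume "s \<le> x"
  then show "\<exists>y. (Lam_late c \<gamma> has_real_derivative y) (at x) \<and> 0 \<le> y"
    using Lam_late_has_derivative[of \<gamma> c x] assms by (auto intro: powr_ge_zero)
qed

lemma Lam_early_pos:
  assumes "0 < c" "0 < \<delta>" "0 < t" "t \<le> t_star c \<gamma> \<delta>"
  shows "0 < Lam_early c \<gamma> \<delta> t"
proof -
  have "ln (2 powr \<gamma> * c * \<delta> powr (1 - \<gamma>) * t) \<le> ln (exp (- 2))"
    using le_t_star_iff(1)[of c \<delta> t \<gamma>] assms by (subst ln_le_cancel_iff) auto
  then show ?thesis using assms by (simp add: Lam_early_def)
qed

lemma Lam_pos:
  assumes "2 \<le> \<gamma>" "0 < c" "0 < \<delta>" "0 < t"
  shows "0 < Lam c \<gamma> \<delta> (Lam_offset c \<gamma> \<delta>) (Lam_offset c \<gamma> \<delta>) t"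
  using assms Lam_early_pos[of c \<delta> _ \<gamma>] t_star_pos[of c \<delta> \<gamma>]
    Lam_late_mono[of \<gamma> c "t_star c \<gamma> \<delta>" t]
  unfolding Lam_eq by (auto intro: add_pos_nonneg)

text \<open>On either side of \<^const>\<open>t_star\<close> the supersolution is at most the derivative of the respective branch of
\<^const>\<open>Lam\<close>. The contribution of \<open>Lam_early\<close> at the left end point has the good sign, so the bound is
uniform in \<open>a\<close> and no improper integral at \<open>0\<close> is needed.\<close>
lemma integral_supersolution_le_Lam:
  assumes "2 \<le> \<gamma>" "0 < c" "0 < \<delta>" "0 < a" "a \<le> t" "a \<le> t_star c \<gamma> \<delta>"
  shows "integral {a..t} (supersolution \<gamma> \<delta> (time_scale c \<gamma> \<delta>))
    \<le> Lam c \<gamma> \<delta> (Lam_offset c \<gamma> \<delta>) (Lam_offset c \<gamma> \<delta>) t"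
proof -
  define \<phi> where "\<phi> = supersolution \<gamma> \<delta> (time_scale c \<gamma> \<delta>)"
  define T where "T = t_star c \<gamma> \<delta>"
  note scale = time_scale_pos[OF assms(2,3)]
  have early: "integral {a..b} \<phi> \<le> Lam_early c \<gamma> \<delta> b" if "a \<le> b" "b \<le> T" for b
  proof -
    have "integral {a..b} \<phi> \<le> Lam_early c \<gamma> \<delta> b - Lam_early c \<gamma> \<delta> a"
      unfolding \<phi>_def
      by (rule integral_le_increment[OF \<open>a \<le> b\<close> _ Lam_early_has_derivative supersolution_le_early])
        (use assms that scale in \<open>auto simp: T_def intro: continuous_on_supersolution\<close>)
    then show ?thesis
      using Lam_early_pos[of c \<delta> a \<gamma>] assms by simp
  qed
  have "integral {a..t} \<phi> \<le> Lam_early c \<gamma> \<delta> T + (Lam_late c \<gamma> t - Lam_late c \<gamma> T)" if "T < t"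
  proof -
    have T: "0 < T" "a \<le> T" using assms t_star_pos by (auto simp: T_def)
    have "integral {T..t} \<phi> \<le> Lam_late c \<gamma> t - Lam_late c \<gamma> T"
      unfolding \<phi>_def
      by (rule integral_le_increment[OF _ _ Lam_late_has_derivative supersolution_le_late])
        (use assms that scale T in \<open>auto simp: T_def intro: continuous_on_supersolution\<close>)
    moreover have "\<phi> integrable_on {a..t}"
      unfolding \<phi>_def using assms scale
      by (intro integrable_continuous_interval continuous_on_supersolution)
    then have "integral {a..t} \<phi> = integral {a..T} \<phi> + integral {T..t} \<phi>"
      using T that by (simp add: Henstock_Kurzweil_Integration.integral_combine)
    ultimately show ?thesis using early[of T] T by simp
  qed
  then show ?thesis
    using early[of t] assms unfolding Lam_eq \<phi>_def T_def by auto
qed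

text \<open>A constant for which \<open>upper_rate c \<gamma> \<delta> * t powr - (1 / (\<gamma> - 1))\<close> dominates the supersolution at all times.\<close>
definition upper_rate :: "real \<Rightarrow> real \<Rightarrow> real \<Rightarrow> real" where
  "upper_rate c \<gamma> \<delta> = 3 * (\<gamma> - 1) / \<delta> * time_scale c \<gamma> \<delta> powr - (1 / (\<gamma> - 1))"

lemma supersolution_le_power:
  assumes "2 \<le> \<gamma>" "0 < c" "0 < \<delta>" "0 < t"
  shows "supersolution \<gamma> \<delta> (time_scale c \<gamma> \<delta>) t \<le> upper_rate c \<gamma> \<delta> * t powr - (1 / (\<gamma> - 1))"
proof -
  note scale = time_scale_pos[OF assms(2,3), of \<gamma>]
  have "ln (1 + decay \<gamma> (time_scale c \<gamma> \<delta> * t)) / \<delta>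
      \<le> 3 * (\<gamma> - 1) * (time_scale c \<gamma> \<delta> * t) powr - (1 / (\<gamma> - 1)) / \<delta>"
    using assms scale by (intro divide_right_mono ln_1_decay_le) auto
  then show ?thesis
    using assms scale by (simp add: supersolution_def upper_rate_def powr_mult)
qed

lemma c_time_gt:
  assumes "2 \<le> \<gamma>" "0 < \<nu>" "0 < t"
  shows "t < c_time \<gamma> t \<nu>"
proof (cases "\<gamma> = 2")
  case False
  define q where "q = (\<gamma> - 2) / (\<gamma> - 1)"
  have q: "0 < q" using assms False by (simp add: q_def)
  have "t = (t powr q) powr (1 / q)" using q assms by (simp add: powr_powr)
  also have "\<dots> < (q * \<nu> + t powr q) powr (1 / q)"
    using q assms by (intro powr_less_mono2) auto
  finally show ?thesis using False by (simp add: c_time_def q_def)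
qed (use assms in \<open>simp add: c_time_def\<close>)

text \<open>The time \<open>c_time \<gamma> t \<nu>\<close> is the one up to which the integral of \<open>s powr - (1 / (\<gamma> - 1))\<close> from \<open>t\<close> equals
\<open>\<nu>\<close>.\<close>
lemma integral_supersolution_le_mult:
  assumes "2 \<le> \<gamma>" "0 < c" "0 < \<delta>" "0 < \<nu>" "0 < t"
  shows "integral {t..c_time \<gamma> t \<nu>} (supersolution \<gamma> \<delta> (time_scale c \<gamma> \<delta>)) \<le> upper_rate c \<gamma> \<delta> * \<nu>"
proof -
  define \<beta> where "\<beta> = 1 / (\<gamma> - 1)"
  define G where "G = (\<lambda>s. if \<gamma> = 2 then ln s else (\<gamma> - 1) / (\<gamma> - 2) * s powr ((\<gamma> - 2) / (\<gamma> - 1)))"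
  have G: "(G has_real_derivative s powr - \<beta>) (at s)" if "0 < s" for s
  proof (cases "\<gamma> = 2")
    case True
    then show ?thesis
      unfolding G_def \<beta>_def using that by (auto intro!: derivative_eq_intros simp: powr_minus field_simps)
  next
    case False
    define q where "q = (\<gamma> - 2) / (\<gamma> - 1)"
    have q: "0 < q" "q - 1 = - \<beta>" "(\<gamma> - 1) / (\<gamma> - 2) = 1 / q"
      using assms False by (auto simp: q_def \<beta>_def field_simps)
    have "((\<lambda>s. 1 / q * s powr q) has_real_derivative 1 / q * (q * s powr (q - 1))) (at s)"
      using that by (auto intro!: derivative_eq_intros)
    then show ?thesis using q False by (simp add: G_def flip: q_def)
  qed
  have "G (c_time \<gamma> t \<nu>) - G t = \<nu>"
  proof (cases "\<gamma> = 2")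
    case True
    then show ?thesis using assms by (simp add: G_def c_time_def ln_mult)
  next
    case False
    define q where "q = (\<gamma> - 2) / (\<gamma> - 1)"
    have q: "0 < q" "(\<gamma> - 1) / (\<gamma> - 2) = 1 / q"
      using assms False by (auto simp: q_def field_simps)
    have "0 < q * \<nu> + t powr q" using q assms by (intro add_pos_nonneg) auto
    then have "c_time \<gamma> t \<nu> powr q = q * \<nu> + t powr q"
      using q False by (simp add: c_time_def powr_powr flip: q_def)
    then have "G (c_time \<gamma> t \<nu>) - G t = 1 / q * (q * \<nu> + t powr q) - 1 / q * t powr q"
      using False q by (simp add: G_def flip: q_def)
    then show ?thesis using q by (simp add: field_simps)
  qed
  moreover have "integral {t..c_time \<gamma> t \<nu>} (supersolution \<gamma> \<delta> (time_scale c \<gamma> \<delta>))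
      \<le> upper_rate c \<gamma> \<delta> * G (c_time \<gamma> t \<nu>) - upper_rate c \<gamma> \<delta> * G t"
  proof (rule integral_le_increment)
    show "t \<le> c_time \<gamma> t \<nu>" using c_time_gt[of \<gamma> \<nu> t] assms by simp
    show "continuous_on {t..c_time \<gamma> t \<nu>} (supersolution \<gamma> \<delta> (time_scale c \<gamma> \<delta>))"
      using assms time_scale_pos by (intro continuous_on_supersolution) auto
    fix s assume s: "t \<le> s" "s \<le> c_time \<gamma> t \<nu>"
    show "((\<lambda>s. upper_rate c \<gamma> \<delta> * G s) has_real_derivative upper_rate c \<gamma> \<delta> * s powr - \<beta>) (at s)"
      using s assms by (intro DERIV_cmult G) auto
    show "supersolution \<gamma> \<delta> (time_scale c \<gamma> \<delta>) s \<le> upper_rate c \<gamma> \<delta> * s powr - \<beta>"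
      unfolding \<beta>_def using s assms by (intro supersolution_le_power) auto
  qed
  ultimately show ?thesis by (simp flip: right_diff_distrib)
qed

lemma upper_rate_pos:
  assumes "2 \<le> \<gamma>" "0 < c" "0 < \<delta>"
  shows "0 < upper_rate c \<gamma> \<delta>"
  using assms time_scale_pos[of c \<delta> \<gamma>] by (simp add: upper_rate_def)

section \<open>Two-sided heat kernel bounds\<close>
lemma heat_kernel_harnack_supersolution:
  assumes adm: "admissible F \<gamma> \<delta> c1 c2" and dom: "dominates_profile F \<gamma> \<delta> c" and "0 < c"
    and k: "jump_kernel k" and k1: "0 < k 1" and p: "heat_kernel k p" and CD: "CD_Upsilon k F"
    and ab: "0 < a" "a < b"
  shows "p a x y \<le> p b z y * exp (integral {a..b} (supersolution \<gamma> \<delta> (time_scale c \<gamma> \<delta>))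
    + 2 * (real_of_int \<bar>x - z\<bar>)\<^sup>2 / (k 1 * (b - a)))"
proof -
  have F: "CD_function F" "2 \<le> \<gamma>" "0 < \<delta>" using adm by (auto simp: admissible_def)
  define A where "A = time_scale c \<gamma> \<delta>"
  have A: "0 < A" using F \<open>0 < c\<close> by (simp add: A_def time_scale_pos)
  show ?thesis
    unfolding A_def[symmetric]
  proof (rule heat_kernel_harnack[OF k k1 p CD CD_function_mono[OF F(1)]
        supersolution_has_derivative[OF F(3) A] supersolution_pos[OF F(3) A] _
        supersolution_blowup[OF F(3) A] ab])
    fix s :: real assume s: "0 < s"
    have pos: "0 < supersolution \<gamma> \<delta> A s" by (rule supersolution_pos[OF F(3) A s])
    have "(1 / (A * s) + (A * s) powr - (1 / (\<gamma> - 1)) / (\<gamma> - 1)) / (s * \<delta> * (1 + decay \<gamma> (A * s)))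
        \<le> F (supersolution \<gamma> \<delta> A s)"
      using supersolution_inequality[OF F(2,3) A s] dom pos
      unfolding dominates_profile_def A_def[symmetric] by (meson order_trans)
    also have "\<dots> \<le> 2 * F (supersolution \<gamma> \<delta> A s)"
      using CD_function_pos[OF F(1) pos] by simp
    finally show "- (- (1 / (A * s) + (A * s) powr - (1 / (\<gamma> - 1)) / (\<gamma> - 1))
        / (s * \<delta> * (1 + decay \<gamma> (A * s)))) \<le> 2 * F (supersolution \<gamma> \<delta> A s)"
      unfolding divide_minus_left minus_minus .
  qed
qed

text \<open>Harnack's inequality from \<open>(a, y)\<close> to \<open>(t, x)\<close> with \<open>a \<rightarrow> 0\<close>, where \<open>p a y y \<rightarrow> 1\<close>.\<close>
lemma heat_kernel_lower_bound:
  assumes adm: "admissible F \<gamma> \<delta> c1 c2" and dom: "dominates_profile F \<gamma> \<delta> c" and "0 < c"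
    and k: "jump_kernel k" and k1: "0 < k 1" and p: "heat_kernel k p" and CD: "CD_Upsilon k F"
    and "0 < t"
  shows "exp (- (Lam c \<gamma> \<delta> (Lam_offset c \<gamma> \<delta>) (Lam_offset c \<gamma> \<delta>) t
    + 2 * (real_of_int \<bar>x - y\<bar>)\<^sup>2 / (k 1 * t))) \<le> p t x y"
proof -
  define \<Lambda> where "\<Lambda> = Lam c \<gamma> \<delta> (Lam_offset c \<gamma> \<delta>) (Lam_offset c \<gamma> \<delta>) t"
  define N where "N = 2 * (real_of_int \<bar>y - x\<bar>)\<^sup>2"
  have F: "2 \<le> \<gamma>" "0 < \<delta>" using adm by (auto simp: admissible_def)
  have le: "p a y y \<le> p t x y * exp (\<Lambda> + N / (k 1 * (t - a)))"
    if a: "0 < a" "a < t" "a < t_star c \<gamma> \<delta>" for a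
  proof -
    have "integral {a..t} (supersolution \<gamma> \<delta> (time_scale c \<gamma> \<delta>)) \<le> \<Lambda>"
      unfolding \<Lambda>_def using F \<open>0 < c\<close> a by (intro integral_supersolution_le_Lam) auto
    then have "p t x y * exp (integral {a..t} (supersolution \<gamma> \<delta> (time_scale c \<gamma> \<delta>)) + N / (k 1 * (t - a)))
        \<le> p t x y * exp (\<Lambda> + N / (k 1 * (t - a)))"
      using heat_kernel_nonneg[OF k p, of t x y] \<open>0 < t\<close> by (intro mult_left_mono) auto
    then show ?thesis
      using heat_kernel_harnack_supersolution[OF adm dom \<open>0 < c\<close> k k1 p CD a(1,2), of y y x]
      unfolding N_def by linarith
  qed
  have "continuous_on {0..} (\<lambda>a. p a y y)" using p by (simp add: heat_kernel_def)
  then have "((\<lambda>a. p a y y) \<longlongrightarrow> p 0 y y) (at 0 within {0..})"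
    by (simp add: continuous_on_def)
  then have lim0: "((\<lambda>a. p a y y) \<longlongrightarrow> 1) (at_right 0)"
    using heat_kernel_0[OF p, of y y] by (auto intro: tendsto_within_subset)
  have "((\<lambda>a. p t x y * exp (\<Lambda> + N / (k 1 * (t - a)))) \<longlongrightarrow> p t x y * exp (\<Lambda> + N / (k 1 * (t - 0))))
      (at_right 0)"
    using k1 \<open>0 < t\<close> by (intro tendsto_intros) auto
  moreover have "\<forall>\<^sub>F a in at_right 0. p a y y \<le> p t x y * exp (\<Lambda> + N / (k 1 * (t - a)))"
    unfolding eventually_at_right_field
    using le \<open>0 < t\<close> t_star_pos[OF \<open>0 < c\<close> F(2), of \<gamma>]
    by (intro exI[of _ "min t (t_star c \<gamma> \<delta>)"]) auto
  ultimately have "1 \<le> p t x y * exp (\<Lambda> + N / (k 1 * (t - 0)))"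
    using lim0 by (intro tendsto_le[of "at_right 0"]) auto
  then have "exp (- (\<Lambda> + N / (k 1 * t))) \<le> p t x y"
    unfolding exp_minus inverse_eq_divide by (simp add: divide_le_eq)
  then show ?thesis by (simp add: \<Lambda>_def N_def abs_minus_commute)
qed

text \<open>Harnack's inequality compares \<open>p t x y\<close> with \<open>p T z y\<close> at the later time \<open>T = c_time \<gamma> t \<nu>\<close> for all \<open>z\<close> within
distance \<open>n\<close> of \<open>x\<close>. As \<open>n\<^sup>2 \<le> T - t\<close>, the loss is at most \<open>upper_rate c \<gamma> \<delta> * \<nu> + 2 / k 1\<close> for each of them. Summing over
these \<open>2 n + 1\<close> sites, the total mass at time \<open>T\<close> is at most \<open>1\<close>.\<close>
lemma heat_kernel_upper_bound:
  assumes adm: "admissible F \<gamma> \<delta> c1 c2" and dom: "dominates_profile F \<gamma> \<delta> c" and "0 < c"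
    and k: "jump_kernel k" and k1: "0 < k 1" and p: "heat_kernel k p" and CD: "CD_Upsilon k F"
    and "0 < t" "0 < \<nu>" and nz: "\<lfloor>sqrt (c_time \<gamma> t \<nu> - t)\<rfloor> \<noteq> 0"
  shows "p t x y \<le> exp (upper_rate c \<gamma> \<delta> * \<nu> + 2 / k 1)
    / (2 * real_of_int \<lfloor>sqrt (c_time \<gamma> t \<nu> - t)\<rfloor>)"
proof -
  have F: "2 \<le> \<gamma>" "0 < \<delta>" using adm by (auto simp: admissible_def)
  define T where "T = c_time \<gamma> t \<nu>"
  have T: "t < T" using c_time_gt[of \<gamma> \<nu> t] F assms by (simp add: T_def)
  define n where "n = \<lfloor>sqrt (T - t)\<rfloor>"
  have "0 \<le> n" using T by (simp add: n_def)
  then have n: "1 \<le> n" using nz unfolding n_def T_def by linarith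
  have nT: "(real_of_int n)\<^sup>2 \<le> T - t"
  proof -
    have "(real_of_int n)\<^sup>2 \<le> (sqrt (T - t))\<^sup>2"
      using n by (intro power_mono) (auto simp: n_def)
    then show ?thesis using T by simp
  qed
  define E where "E = exp (upper_rate c \<gamma> \<delta> * \<nu> + 2 / k 1)"
  have "p t x y \<le> p T z y * E" if z: "z \<in> {x - n..x + n}" for z
  proof -
    have "(real_of_int \<bar>x - z\<bar>)\<^sup>2 \<le> (real_of_int n)\<^sup>2"
      using z by (intro power_mono) auto
    then have "2 * (real_of_int \<bar>x - z\<bar>)\<^sup>2 / (k 1 * (T - t)) \<le> 2 * (T - t) / (k 1 * (T - t))"
      using nT k1 T by (intro divide_right_mono) auto
    also have "\<dots> = 2 / k 1" using T by (intro mult_divide_mult_cancel_right) auto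
    finally have "integral {t..T} (supersolution \<gamma> \<delta> (time_scale c \<gamma> \<delta>))
        + 2 * (real_of_int \<bar>x - z\<bar>)\<^sup>2 / (k 1 * (T - t)) \<le> upper_rate c \<gamma> \<delta> * \<nu> + 2 / k 1"
      using integral_supersolution_le_mult[OF F(1) \<open>0 < c\<close> F(2) \<open>0 < \<nu>\<close> \<open>0 < t\<close>]
      unfolding T_def by linarith
    then have "p T z y * exp (integral {t..T} (supersolution \<gamma> \<delta> (time_scale c \<gamma> \<delta>))
        + 2 * (real_of_int \<bar>x - z\<bar>)\<^sup>2 / (k 1 * (T - t))) \<le> p T z y * E"
      unfolding E_def using heat_kernel_nonneg[OF k p, of T z y] T \<open>0 < t\<close>
      by (intro mult_left_mono) auto
    then show ?thesis
      using heat_kernel_harnack_supersolution[OF adm dom \<open>0 < c\<close> k k1 p CD \<open>0 < t\<close> T, of x y z]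
      by linarith
  qed
  then have "(\<Sum>z\<in>{x - n..x + n}. p t x y) \<le> (\<Sum>z\<in>{x - n..x + n}. p T z y * E)"
    by (rule sum_mono)
  also have "\<dots> = (\<Sum>z\<in>{x - n..x + n}. p T z y) * E" by (simp add: sum_distrib_right)
  also have "\<dots> \<le> 1 * E"
    using heat_kernel_sum_le_1[OF k p, of T "{x - n..x + n}" y] T \<open>0 < t\<close>
    by (intro mult_right_mono) (auto simp: E_def)
  finally have "(2 * real_of_int n + 1) * p t x y \<le> E" using n by simp
  moreover have "0 \<le> p t x y" using heat_kernel_nonneg[OF k p] \<open>0 < t\<close> by simp
  ultimately have "2 * real_of_int n * p t x y \<le> E" by (simp add: algebra_simps)
  then show ?thesis
    using n by (simp add: E_def n_def T_def field_simps)
qed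

theorem theorem6p9:
  "\<exists>(c :: (real \<Rightarrow> real) \<Rightarrow> real) (\<tau>1 :: real \<Rightarrow> real \<Rightarrow> real \<Rightarrow> real)
      (\<tau>2 :: real \<Rightarrow> real \<Rightarrow> real \<Rightarrow> real) (C0 :: real \<Rightarrow> real \<Rightarrow> real \<Rightarrow> real).
   \<forall>(F :: real \<Rightarrow> real) \<gamma> \<delta> c1 c2.
     CD_function F \<and> 2 \<le> \<gamma> \<and> 0 < \<delta> \<and> 0 < c1 \<and> 0 < c2 \<and>
     F \<sim>[at_right 0] (\<lambda>x. c1 * x powr \<gamma>) \<and> F \<sim>[at_top] (\<lambda>x. c2 * exp (\<delta> * x)) \<longrightarrow>
     0 < c F \<and> 0 < C0 (c F) \<gamma> \<delta> \<and>
     (\<forall>t>0. 0 < Lam (c F) \<gamma> \<delta> (\<tau>1 (c F) \<gamma> \<delta>) (\<tau>2 (c F) \<gamma> \<delta>) t) \<and>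
     (\<forall>(\<alpha> :: real) (k :: int \<Rightarrow> real) (p :: real \<Rightarrow> int \<Rightarrow> int \<Rightarrow> real).
        0 < \<alpha> \<and> jump_kernel k \<and> 0 < k 1 \<and>
        (\<lambda>j. k j * real_of_int \<bar>j\<bar> powr \<alpha>) summable_on UNIV \<and>
        CD_Upsilon k F \<and> heat_kernel k p \<longrightarrow>
        (\<forall>\<nu>>0. \<forall>x y. \<forall>t>0.
           exp (- (Lam (c F) \<gamma> \<delta> (\<tau>1 (c F) \<gamma> \<delta>) (\<tau>2 (c F) \<gamma> \<delta>) t
                   + 2 * (real_of_int \<bar>x - y\<bar>)\<^sup>2 / (k 1 * t))) \<le> p t x y \<and>
           (\<lfloor>sqrt (c_time \<gamma> t \<nu> - t)\<rfloor> \<noteq> 0 \<longrightarrow>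
              p t x y \<le> exp (C0 (c F) \<gamma> \<delta> * \<nu> + 2 / k 1)
                / (2 * real_of_int \<lfloor>sqrt (c_time \<gamma> t \<nu> - t)\<rfloor>))))"
proof -
  have "\<forall>F. \<exists>c>0. \<forall>\<gamma> \<delta> c1 c2. admissible F \<gamma> \<delta> c1 c2 \<longrightarrow> dominates_profile F \<gamma> \<delta> c"
    using ex_dominating_constant by blast
  from choice[OF this] obtain c where
    c: "\<And>F. 0 < c F" "\<And>F \<gamma> \<delta> c1 c2. admissible F \<gamma> \<delta> c1 c2 \<Longrightarrow> dominates_profile F \<gamma> \<delta> (c F)"
    by blast
  show ?thesis
  proof (rule exI[of _ c], rule exI[of _ Lam_offset], rule exI[of _ Lam_offset],
      rule exI[of _ upper_rate], intro allI impI)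
    fix F :: "real \<Rightarrow> real" and \<gamma> \<delta> c1 c2 :: real
    assume "CD_function F \<and> 2 \<le> \<gamma> \<and> 0 < \<delta> \<and> 0 < c1 \<and> 0 < c2 \<and>
      F \<sim>[at_right 0] (\<lambda>x. c1 * x powr \<gamma>) \<and> F \<sim>[at_top] (\<lambda>x. c2 * exp (\<delta> * x))"
    then have adm: "admissible F \<gamma> \<delta> c1 c2" by (simp only: admissible_def)
    then have F: "2 \<le> \<gamma>" "0 < \<delta>" by (auto simp: admissible_def)
    note dom = c(2)[OF adm]
    show "0 < c F \<and> 0 < upper_rate (c F) \<gamma> \<delta> \<and>
     (\<forall>t>0. 0 < Lam (c F) \<gamma> \<delta> (Lam_offset (c F) \<gamma> \<delta>) (Lam_offset (c F) \<gamma> \<delta>) t) \<and>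
     (\<forall>(\<alpha> :: real) (k :: int \<Rightarrow> real) (p :: real \<Rightarrow> int \<Rightarrow> int \<Rightarrow> real).
        0 < \<alpha> \<and> jump_kernel k \<and> 0 < k 1 \<and>
        (\<lambda>j. k j * real_of_int \<bar>j\<bar> powr \<alpha>) summable_on UNIV \<and>
        CD_Upsilon k F \<and> heat_kernel k p \<longrightarrow>
        (\<forall>\<nu>>0. \<forall>x y. \<forall>t>0.
           exp (- (Lam (c F) \<gamma> \<delta> (Lam_offset (c F) \<gamma> \<delta>) (Lam_offset (c F) \<gamma> \<delta>) t
                   + 2 * (real_of_int \<bar>x - y\<bar>)\<^sup>2 / (k 1 * t))) \<le> p t x y \<and>
           (\<lfloor>sqrt (c_time \<gamma> t \<nu> - t)\<rfloor> \<noteq> 0 \<longrightarrow>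
              p t x y \<le> exp (upper_rate (c F) \<gamma> \<delta> * \<nu> + 2 / k 1)
                / (2 * real_of_int \<lfloor>sqrt (c_time \<gamma> t \<nu> - t)\<rfloor>))))"
      using c(1) upper_rate_pos[OF F(1) c(1) F(2)] Lam_pos[OF F(1) c(1) F(2)]
        heat_kernel_lower_bound[OF adm dom c(1)] heat_kernel_upper_bound[OF adm dom c(1)]
      by (intro conjI allI impI) (elim conjE, assumption | blast)+
  qed
qed

end
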